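(* Let $0\le \alpha<\tfrac12$ and let $a_m\ge 0$ ($m\in\mathbb N$) be a sequence with $a_m\to 0$ as $m\to\infty$. Then there is a function $f$, with $x^{\alpha+1}f(x)\in L^1([0,1])$, whose Bessel--Fourier coefficients of order zero, $f_m$, satisfy $$0\le a_m\le \frac{f_m}{j_m^{\alpha}}\quad\text{for all } m\in\mathbb N,\qquad\text{and}\qquad \frac{f_m}{j_m^{\alpha}}\to 0\ \text{ as } m\to\infty.$$ Furthermore, $f$ can be chosen so that $f_{2m}=0$ for all $m\in\mathbb N$, or so that $f_{2m+1}=0$ for all $m\in\mathbb N$.
   Context: $\mathbb N$ is the set of positive integers. $J_0$ and $J_1$ denote the Bessel functions of the first kind of orders $0$ and $1$. For $m\in\mathbb N$, $j_m>0$ denotes the $m$-th positive zero of $J_0$ (in increasing order). $L^1([0,1])$ is taken with respect to Lebesgue measure $dx$. The Bessel--Fourier coefficients of order zero of a function $f$ on $[0,1]$ are $$f_m:=\frac{2}{J_1(j_m)^2}\int_0^1 f(x)J_0(j_mx)\,x\,dx,\qquad m\in\mathbb N.$$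
   Formalization: In the "Furthermore" part, the lower bound a_m ≤ f_m/j_m^α is required only at indices m where f_m is not made to vanish, since f_{2m}=0 (or f_{2m+1}=0) would contradict it whenever a is positive at such an index. *)

theory Defs
  imports "HOL-Analysis.Analysis"
begin

definition bessel_J :: "nat \<Rightarrow> real \<Rightarrow> real" where
  "bessel_J n x = (\<Sum>k. (-1) ^ k / (fact k * fact (k + n)) * (x / 2) ^ (2 * k + n))"

text \<open>The \<open>m\<close>-th positive zero of \<open>J\<^sub>0\<close> for \<open>m \<ge> 1\<close>: the positive zero \<open>x\<close> for which there are
  exactly \<open>m\<close> zeros in \<open>(0, x]\<close>.  The value at \<open>m = 0\<close> is meaningless.\<close>

definition bessel_J0_zero :: "nat \<Rightarrow> real" where
  "bessel_J0_zero m =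
     (THE x. 0 < x \<and> bessel_J 0 x = 0 \<and> card {y. 0 < y \<and> y \<le> x \<and> bessel_J 0 y = 0} = m)"

text \<open>The Lebesgue integral is \<open>0\<close> by convention when the integrand is not integrable, so
  existence of the integrals defining the coefficients is a separate predicate.  It is not implied
  by integrability of \<open>x powr (\<alpha> + 1) * f x\<close> when \<open>\<alpha> > 0\<close>.\<close>

definition bessel_coeffs_exist :: "(real \<Rightarrow> real) \<Rightarrow> bool" where
  "bessel_coeffs_exist f \<longleftrightarrow>
     (\<forall>m\<ge>1. (\<lambda>x. f x * bessel_J 0 (bessel_J0_zero m * x) * x) absolutely_integrable_on {0..1})"

definition bessel_coeff :: "(real \<Rightarrow> real) \<Rightarrow> nat \<Rightarrow> real" where
  "bessel_coeff f m =
     2 / (bessel_J 1 (bessel_J0_zero m))\<^sup>2 *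
     (LINT x:{0..1}|lebesgue. f x * bessel_J 0 (bessel_J0_zero m * x) * x)"

end

theory Submission
  imports Defs
begin

text \<open>
  The function sought is a Bessel--Fourier series whose coefficients decrease monotonically after
  removal of a power, restricted to one residue class of indices modulo \<open>2\<close>.  Replace \<open>a\<close> by a
  decreasing null sequence \<open>s \<ge> a\<close>, put \<open>\<gamma> = 1 / 2 - \<alpha> > 0\<close>, and consider, for \<open>p = 1\<close> or \<open>p = 2\<close>,
  \<open>f x = (\<Sum>k. s\<^sub>m m\<^bsup>-\<gamma>\<^esup> j\<^sub>m\<^bsup>1/2\<^esup> J\<^sub>0 (j\<^sub>m x))\<close> with \<open>m = 2 k + p\<close>.
  If \<open>x f x\<close> is integrable and integration may be carried out term by term, then orthogonality of
  the functions \<open>J\<^sub>0 (j\<^sub>m x)\<close> with respect to \<open>x dx\<close> gives the coefficients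
  \<open>f\<^sub>m = s\<^sub>m m\<^bsup>-\<gamma>\<^esup> j\<^sub>m\<^bsup>1/2\<^esup>\<close> in the class of \<open>p\<close> and \<open>0\<close> outside.  Since
  \<open>m \<le> j\<^sub>m \<le> 5 m\<close>, the quotient \<open>f\<^sub>m / j\<^sub>m\<^bsup>\<alpha>\<^esup> = s\<^sub>m (j\<^sub>m / m)\<^bsup>\<gamma>\<^esup>\<close> lies between \<open>s\<^sub>m\<close> and
  \<open>5 s\<^sub>m\<close>.  The two series and their sum settle the first two claims;
  for the last one a multiple of \<open>J\<^sub>0 (j\<^sub>1 x)\<close> is added to the series with \<open>p = 2\<close>.

  Everything rests on one integrable bound for \<open>x\<close> times the partial sums.  The asymptotics
  \<open>J\<^sub>0 y = y\<^bsup>-1/2\<^esup> (R cos (y + L) + O (1 / y))\<close> and \<open>j\<^sub>m = \<pi> m + c + O (1 / m)\<close> turn the partial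
  sum into \<open>x\<^bsup>-1/2\<^esup>\<close> times
  \<open>R (\<Sum>k. s\<^sub>m m\<^bsup>-\<gamma>\<^esup> cos (2 \<pi> k x + \<psi> x)) + O (\<Sum>m. m\<^bsup>-\<gamma>-1\<^esup> / x)\<close>.
  The error is summable in absolute value.  The main part has decreasing coefficients, so summation
  by parts bounds it by a multiple of \<open>\<bar>sin (\<pi> x)\<bar>\<^bsup>\<gamma>-1\<^esup>\<close>
  (\<open>abs_monotone_cos_sum_le\<close>).  Both singularities \<open>x = 0\<close> and \<open>x = 1\<close> are integrable because
  \<open>\<gamma> > 0\<close>, that is \<open>\<alpha> < 1 / 2\<close>.
  Dominated convergence then does the rest (\<open>bessel_series_on_residue_class\<close>).

  It is enough that some constants \<open>R\<close>, \<open>L\<close> and \<open>c\<close> exist, so the asymptotics can be read off the Bessel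
  equation alone.  The function \<open>u x = x\<^bsup>1/2\<^esup> J\<^sub>0 x\<close> satisfies \<open>u'' = - (1 + 1 / (4 x\<^sup>2)) u\<close>; in polar
  coordinates \<open>u = r cos \<theta>\<close>, \<open>u' = - r sin \<theta>\<close> both \<open>r\<close> and \<open>\<theta> x - x\<close> have derivatives of size
  \<open>O (1 / x\<^sup>2)\<close> (\<open>pruefer_variables\<close>).  The angle is strictly increasing and starts in
  \<open>(- \<pi> / 2, \<pi> / 2)\<close> at \<open>x = 1\<close>, so it also counts the zeros:
  \<open>\<theta> j\<^sub>m = \<pi> m - \<pi> / 2\<close> (\<open>bessel_J0_zeros\<close>).
\<close>

section \<open>Bessel functions of orders zero and one\<close>

text \<open>
  The entire function \<open>g\<^sub>n\<close> with \<open>J\<^sub>n x = (x / 2)\<^sup>n g\<^sub>n (x\<^sup>2 / 4)\<close>.  Its coefficients make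
  \<open>g\<^sub>n' = - g\<^bsub>n+1\<^esub>\<close> immediate, and the Bessel equation follows from a three-term recurrence.
\<close>

definition bessel_series :: "nat \<Rightarrow> real \<Rightarrow> real" where
  "bessel_series n z = (\<Sum>k. (-1) ^ k / (fact k * fact (k + n)) * z ^ k)"

lemma summable_bessel_series:
  "summable (\<lambda>k. (-1) ^ k / (fact k * fact (k + n)) * (z::real) ^ k)"
proof (rule summable_comparison_test')
  show "summable (\<lambda>k. inverse (fact k) * \<bar>z\<bar> ^ k)"
    by (rule summable_exp)
  fix k :: nat
  have "(1::real) \<le> fact (k + n)"
    by (rule fact_ge_1)
  then have "1 / (fact k * fact (k + n)) \<le> (1::real) / fact k"
    by (intro divide_left_mono) (simp_all add: mult_le_cancel_left1)
  then have "1 / (fact k * fact (k + n)) * \<bar>z\<bar> ^ k \<le> 1 / fact k * \<bar>z\<bar> ^ k"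
    by (intro mult_right_mono) auto
  then show "norm ((-1) ^ k / (fact k * fact (k + n)) * z ^ k) \<le> inverse (fact k) * \<bar>z\<bar> ^ k"
    by (simp add: abs_mult power_abs inverse_eq_divide)
qed

lemma bessel_series_has_derivative:
  "(bessel_series n has_real_derivative - bessel_series (Suc n) z) (at z)"
proof -
  let ?c = "\<lambda>k. (-1) ^ k / (fact k * fact (k + n)) :: real"
  have "((\<lambda>z. \<Sum>k. ?c k * z ^ k) has_real_derivative (\<Sum>k. diffs ?c k * z ^ k)) (at z)"
    by (rule termdiffs_strong_converges_everywhere) (rule summable_bessel_series)
  moreover have "diffs ?c k = - ((-1) ^ k / (fact k * fact (k + Suc n)))" for k
    by (simp add: diffs_def field_simps del: of_nat_Suc)
  ultimately show ?thesis
    using summable_bessel_series[of "Suc n" z]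
    by (simp add: bessel_series_def [abs_def] suminf_minus)
qed

lemma bessel_series_recurrence:
  "z * bessel_series 2 z = bessel_series 1 z - bessel_series 0 z"
proof -
  let ?t = "\<lambda>n k. (-1) ^ k / (fact k * fact (k + n)) * z ^ k :: real"
  have s: "summable (?t n)" for n by (rule summable_bessel_series)
  have "bessel_series 1 z - bessel_series 0 z = (\<Sum>k. ?t 1 k - ?t 0 k)"
    unfolding bessel_series_def by (rule suminf_diff [OF s s])
  also have "\<dots> = (\<Sum>k. ?t 1 (Suc k) - ?t 0 (Suc k)) + (?t 1 0 - ?t 0 0)"
    using suminf_split_head [OF summable_diff [OF s s], of 1 0] by simp
  also have "(\<lambda>k. ?t 1 (Suc k) - ?t 0 (Suc k)) = (\<lambda>k. z * ?t 2 k)"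
    by (rule ext) (simp add: divide_simps, simp add: algebra_simps)
  also have "(\<Sum>k. z * ?t 2 k) = z * bessel_series 2 z"
    unfolding bessel_series_def by (rule suminf_mult [OF s])
  finally show ?thesis by simp
qed

lemma bessel_J_eq_series: "bessel_J n x = (x / 2) ^ n * bessel_series n (x\<^sup>2 / 4)"
proof -
  have "(x / 2) ^ n * bessel_series n (x\<^sup>2 / 4)
      = (\<Sum>k. (x / 2) ^ n * ((-1) ^ k / (fact k * fact (k + n)) * (x\<^sup>2 / 4) ^ k))"
    unfolding bessel_series_def by (rule suminf_mult [symmetric, OF summable_bessel_series])
  also have "x\<^sup>2 / 4 = (x / 2)\<^sup>2"
    by (simp add: power_divide)
  also have "(\<lambda>k. (x / 2) ^ n * ((-1) ^ k / (fact k * fact (k + n)) * ((x / 2)\<^sup>2) ^ k))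
      = (\<lambda>k. (-1) ^ k / (fact k * fact (k + n)) * (x / 2) ^ (2 * k + n))"
    by (simp add: power_mult power_add mult_ac flip: power_mult)
  also have "(\<Sum>k. (-1) ^ k / (fact k * fact (k + n)) * (x / 2) ^ (2 * k + n)) = bessel_J n x"
    by (simp add: bessel_J_def)
  finally show ?thesis
    by (simp add: power_divide)
qed

lemma bessel_J0_has_derivative [derivative_intros]:
  assumes "(g has_real_derivative g') (at x within S)"
  shows "((\<lambda>x. bessel_J 0 (g x)) has_real_derivative - bessel_J 1 (g x) * g') (at x within S)"
proof -
  have "((\<lambda>y. bessel_series 0 (y\<^sup>2 / 4)) has_real_derivative - bessel_series 1 (y\<^sup>2 / 4) * (y / 2)) (at y)" for y
    by (rule DERIV_cong, rule DERIV_chain2 [OF bessel_series_has_derivative])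
       (auto intro!: derivative_eq_intros)
  then have "(bessel_J 0 has_real_derivative - bessel_J 1 y) (at y)" for y
    by (simp add: bessel_J_eq_series [abs_def] mult_ac)
  from DERIV_chain2 [OF this assms] show ?thesis .
qed

text \<open>The origin is excluded: there the formula would read \<open>J\<^sub>0 0 - J\<^sub>1 0 / 0 = 1\<close>, whereas \<open>J\<^sub>1' 0 = 1 / 2\<close>.\<close>

lemma bessel_J1_has_derivative [derivative_intros]:
  assumes "(g has_real_derivative g') (at x within S)" and "g x \<noteq> 0"
  shows "((\<lambda>x. bessel_J 1 (g x)) has_real_derivative (bessel_J 0 (g x) - bessel_J 1 (g x) / g x) * g')
           (at x within S)"
proof -
  have "(bessel_J 1 has_real_derivative (bessel_J 0 y - bessel_J 1 y / y)) (at y)" if "y \<noteq> 0" for y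
  proof -
    let ?g = "\<lambda>n. bessel_series n (y\<^sup>2 / 4)"
    have d: "((\<lambda>y. bessel_series 1 (y\<^sup>2 / 4)) has_real_derivative - ?g 2 * (y / 2)) (at y)"
      by (rule DERIV_cong, rule DERIV_chain2 [OF bessel_series_has_derivative])
         (auto intro!: derivative_eq_intros simp: numeral_2_eq_2)
    have "(bessel_J 1 has_real_derivative ?g 1 / 2 + y / 2 * (- ?g 2 * (y / 2))) (at y)"
      unfolding bessel_J_eq_series [abs_def]
      by (auto intro!: derivative_eq_intros d simp del: One_nat_def)
    also have "?g 1 / 2 + y / 2 * (- ?g 2 * (y / 2)) = ?g 1 / 2 - y\<^sup>2 / 4 * ?g 2"
      by (simp add: power2_eq_square)
    also have "\<dots> = ?g 0 - ?g 1 / 2"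
      by (simp add: bessel_series_recurrence)
    also have "\<dots> = bessel_J 0 y - bessel_J 1 y / y"
      using that by (simp add: bessel_J_eq_series)
    finally show ?thesis .
  qed
  from DERIV_chain2 [OF this [OF assms(2)] assms(1)] show ?thesis .
qed

lemma continuous_on_bessel_J [continuous_intros]:
  assumes "continuous_on S g"
  shows "continuous_on S (\<lambda>x. bessel_J n (g x))"
proof -
  have "continuous_on UNIV (bessel_series n)"
    by (intro DERIV_continuous_on [OF has_field_derivative_at_within]) (rule bessel_series_has_derivative)
  then have "continuous_on UNIV (bessel_J n)"
    unfolding bessel_J_eq_series [abs_def]
    by (intro continuous_intros continuous_on_compose2 [where f = "\<lambda>x. x\<^sup>2 / 4" and t = UNIV]) auto
  then show ?thesis
    using assms by (rule continuous_on_compose2) auto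
qed

text \<open>The absolute values of all terms after the first add up to at most \<open>exp (1 / 4) - 1 < 1\<close>.\<close>

lemma bessel_J0_pos:
  assumes "0 \<le> x" "x \<le> 1"
  shows "bessel_J 0 x > 0"
proof -
  let ?z = "x\<^sup>2 / 4"
  let ?t = "\<lambda>k. (-1) ^ k / (fact k * fact k) * ?z ^ k :: real"
  have s: "summable ?t" using summable_bessel_series[of 0 ?z] by simp
  have e: "(\<lambda>k. inverse (fact k) * ?z ^ k) sums exp ?z"
    using exp_converges[of ?z] by simp
  have z: "0 \<le> ?z" "?z \<le> 1 / 4"
    using assms by (auto simp: power_le_one)
  have "norm (\<Sum>k. ?t (Suc k)) \<le> (\<Sum>k. inverse (fact (Suc k)) * ?z ^ Suc k)"
  proof (rule norm_suminf_le)
    show "summable (\<lambda>k. inverse (fact (Suc k)) * ?z ^ Suc k)"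
      using e by (subst summable_Suc_iff) (rule sums_summable)
    fix k
    have "1 / (fact (Suc k) * fact (Suc k)) \<le> (1::real) / fact (Suc k)"
      using fact_ge_1 [of "Suc k", where 'a = real]
      by (intro divide_left_mono) (simp_all only: mult_le_cancel_left1, auto)
    then have "1 / (fact (Suc k) * fact (Suc k)) * ?z ^ Suc k \<le> 1 / fact (Suc k) * ?z ^ Suc k"
      using z by (intro mult_right_mono) auto
    then show "norm (?t (Suc k)) \<le> inverse (fact (Suc k)) * ?z ^ Suc k"
      using z by (simp add: abs_mult power_abs inverse_eq_divide)
  qed
  also have "\<dots> = exp ?z - 1"
    using suminf_split_head [OF sums_summable [OF e]] sums_unique [OF e] by simp
  also have "exp ?z \<le> exp (1 / 4)" using z by simp
  also have "exp (1 / 4) < (2::real)"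
    using exp_bound[of "1 / 4"] by (simp add: power2_eq_square)
  finally have "\<bar>\<Sum>k. ?t (Suc k)\<bar> < 1" by simp
  moreover have "bessel_J 0 x = 1 + (\<Sum>k. ?t (Suc k))"
    using suminf_split_head [OF s] by (simp add: bessel_J_eq_series bessel_series_def)
  ultimately show ?thesis by linarith
qed

section \<open>Orthogonality\<close>

text \<open>
  The two indefinite integrals of Lommel: products of \<open>J\<^sub>0 (a x)\<close> and \<open>J\<^sub>0 (b x)\<close> have elementary
  antiderivatives in terms of \<open>J\<^sub>0\<close> and \<open>J\<^sub>1\<close>, whose boundary values at zeros \<open>a\<close>, \<open>b\<close> of \<open>J\<^sub>0\<close>
  give orthogonality and the norms.
\<close>

lemma lommel_orthogonality_antiderivative:
  assumes "a > 0" "b > 0" "x > 0"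
  shows "((\<lambda>x. x * (a * bessel_J 1 (a * x) * bessel_J 0 (b * x)
                    - b * bessel_J 0 (a * x) * bessel_J 1 (b * x)))
          has_real_derivative (a\<^sup>2 - b\<^sup>2) * (bessel_J 0 (a * x) * bessel_J 0 (b * x) * x)) (at x)"
  using assms
  by (auto intro!: derivative_eq_intros simp: field_simps power2_eq_square simp del: One_nat_def)

lemma lommel_norm_antiderivative:
  assumes "a > 0" "x > 0"
  shows "((\<lambda>x. x\<^sup>2 / 2 * ((bessel_J 0 (a * x))\<^sup>2 + (bessel_J 1 (a * x))\<^sup>2))
          has_real_derivative bessel_J 0 (a * x) * bessel_J 0 (a * x) * x) (at x)"
  using assms
  by (auto intro!: derivative_eq_intros simp: field_simps power2_eq_square simp del: One_nat_def)

lemma bessel_J0_integral: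
  assumes "a > 0" "b > 0" "bessel_J 0 a = 0" "bessel_J 0 b = 0"
  shows "((\<lambda>x. bessel_J 0 (a * x) * bessel_J 0 (b * x) * x) has_integral
           (if a = b then (bessel_J 1 a)\<^sup>2 / 2 else 0)) {0..1}"
proof (cases "a = b")
  case True
  have "((\<lambda>x. bessel_J 0 (a * x) * bessel_J 0 (a * x) * x) has_integral
      1\<^sup>2 / 2 * ((bessel_J 0 (a * 1))\<^sup>2 + (bessel_J 1 (a * 1))\<^sup>2)
      - 0\<^sup>2 / 2 * ((bessel_J 0 (a * 0))\<^sup>2 + (bessel_J 1 (a * 0))\<^sup>2)) {0..1}"
    by (intro fundamental_theorem_of_calculus_interior continuous_intros
          lommel_norm_antiderivative [THEN has_real_derivative_iff_has_vector_derivative [THEN iffD1]])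
       (use assms in auto)
  then show ?thesis using True assms by simp
next
  case False
  let ?F = "\<lambda>x. x * (a * bessel_J 1 (a * x) * bessel_J 0 (b * x)
                    - b * bessel_J 0 (a * x) * bessel_J 1 (b * x))"
  have "((\<lambda>x. (a\<^sup>2 - b\<^sup>2) * (bessel_J 0 (a * x) * bessel_J 0 (b * x) * x)) has_integral ?F 1 - ?F 0) {0..1}"
    by (intro fundamental_theorem_of_calculus_interior continuous_intros
          lommel_orthogonality_antiderivative
            [THEN has_real_derivative_iff_has_vector_derivative [THEN iffD1]])
       (use assms in auto)
  then have "((\<lambda>x. (a\<^sup>2 - b\<^sup>2) * (bessel_J 0 (a * x) * bessel_J 0 (b * x) * x)) has_integral 0) {0..1}"
    using assms by simp
  from has_integral_mult_right [OF this, of "1 / (a\<^sup>2 - b\<^sup>2)"]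
  show ?thesis
    using False assms by (simp add: power2_eq_iff)
qed

section \<open>The Pruefer transformation\<close>

text \<open>
  The functions \<open>g x - K / x\<close> and \<open>g x + K / x\<close> are increasing and decreasing respectively, and
  the limit \<open>L\<close> is squeezed between them.
\<close>

lemma limit_with_rate_of_derivative_bound:
  fixes g g' :: "real \<Rightarrow> real"
  assumes deriv: "\<And>x. x \<ge> 1 \<Longrightarrow> (g has_real_derivative g' x) (at x)"
    and bound: "\<And>x. x \<ge> 1 \<Longrightarrow> \<bar>g' x\<bar> \<le> K / x\<^sup>2"
  obtains L where "\<And>x. x \<ge> 1 \<Longrightarrow> \<bar>g x - L\<bar> \<le> K / x"
proof -
  have K: "0 \<le> K"
    using bound[of 1] by simp
  have lower: "g x - K / x \<le> g y - K / y" if "1 \<le> x" "x \<le> y" for x y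
  proof (rule DERIV_nonneg_imp_nondecreasing [OF \<open>x \<le> y\<close>])
    fix t assume t: "x \<le> t" "t \<le> y"
    then have "t \<ge> 1" using that by simp
    have "((\<lambda>t. g t - K / t) has_real_derivative g' t + K / t\<^sup>2) (at t)"
      using \<open>t \<ge> 1\<close> by (auto intro!: derivative_eq_intros deriv simp: power2_eq_square)
    then show "\<exists>d. ((\<lambda>t. g t - K / t) has_real_derivative d) (at t) \<and> 0 \<le> d"
      using bound [OF \<open>t \<ge> 1\<close>] by (intro exI conjI) auto
  qed
  have upper: "g y + K / y \<le> g x + K / x" if "1 \<le> x" "x \<le> y" for x y
  proof (rule DERIV_nonpos_imp_nonincreasing [OF \<open>x \<le> y\<close>])
    fix t assume t: "x \<le> t" "t \<le> y"
    then have "t \<ge> 1" using that by simp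
    have "((\<lambda>t. g t + K / t) has_real_derivative g' t - K / t\<^sup>2) (at t)"
      using \<open>t \<ge> 1\<close> by (auto intro!: derivative_eq_intros deriv simp: power2_eq_square)
    then show "\<exists>d. ((\<lambda>t. g t + K / t) has_real_derivative d) (at t) \<and> d \<le> 0"
      using bound [OF \<open>t \<ge> 1\<close>] by (intro exI conjI) auto
  qed
  have le: "g x - K / x \<le> g y + K / y" if "1 \<le> x" "1 \<le> y" for x y
  proof -
    have "0 \<le> K / max x y" using K that by simp
    then show ?thesis
      using lower [of x "max x y"] upper [of y "max x y"] that by linarith
  qed
  define L where "L = (SUP x\<in>{1..}. g x - K / x)"
  have bdd: "bdd_above ((\<lambda>x. g x - K / x) ` {1..})"
    using le [of _ 1] by (intro bdd_aboveI2 [of _ _ "g 1 + K / 1"]) auto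
  have "g x - K / x \<le> L" if "x \<ge> 1" for x
    unfolding L_def using that by (intro cSUP_upper bdd) auto
  moreover have "L \<le> g x + K / x" if "x \<ge> 1" for x
    unfolding L_def using that le by (intro cSUP_least) auto
  ultimately have "\<bar>g x - L\<bar> \<le> K / x" if "x \<ge> 1" for x
    using that by (force simp: abs_le_iff algebra_simps)
  then show ?thesis by (rule that)
qed

text \<open>
  Polar coordinates in the phase plane for a solution of \<open>u'' = - (1 + 1 / (4 x\<^sup>2)) u\<close>.  For the
  equation \<open>u'' = - u\<close> the point \<open>(u, u')\<close> moves on a circle with unit angular speed; the
  perturbation of size \<open>1 / (4 x\<^sup>2)\<close> contributes at most that order to the angular speed and to
  the logarithmic derivative of the radius.  The angle is obtained by integrating the speed
  \<open>1 + q\<close> that it must have, with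
  \<open>q = u\<^sup>2 / (4 x\<^sup>2 r\<^sup>2)\<close>, and it is checked afterwards that rotating \<open>(u, u')\<close> back by this
  angle gives a constant direction.  Positivity of \<open>u\<close> up to \<open>1\<close> keeps the radius away from \<open>0\<close>
  there and allows the initial angle to be an arctangent.
\<close>

lemma pruefer_variables:
  fixes u v :: "real \<Rightarrow> real"
  assumes u: "\<And>x. x > 0 \<Longrightarrow> (u has_real_derivative v x) (at x)"
    and v: "\<And>x. x > 0 \<Longrightarrow> (v has_real_derivative - (1 + 1 / (4 * x\<^sup>2)) * u x) (at x)"
    and pos: "\<And>x. 0 < x \<Longrightarrow> x \<le> 1 \<Longrightarrow> u x > 0"
  obtains r \<theta> r' :: "real \<Rightarrow> real" and K :: real and q :: "real \<Rightarrow> real" where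
    "\<And>x. x \<ge> 1 \<Longrightarrow> r x > 0"
    "\<And>x. x \<ge> 1 \<Longrightarrow> u x = r x * cos (\<theta> x)"
    "\<And>x. x \<ge> 1 \<Longrightarrow> v x = - r x * sin (\<theta> x)"
    "\<And>x. x \<ge> 1 \<Longrightarrow> (r has_real_derivative r' x) (at x)"
    "\<And>x. x \<ge> 1 \<Longrightarrow> \<bar>r' x\<bar> \<le> K / x\<^sup>2"
    "\<And>x. x \<ge> 1 \<Longrightarrow> (\<theta> has_real_derivative 1 + q x) (at x)"
    "\<And>x. x \<ge> 1 \<Longrightarrow> 0 \<le> q x \<and> q x \<le> 1 / (4 * x\<^sup>2)"
    "- (pi / 2) < \<theta> 1" "\<theta> 1 < pi / 2"
proof -
  define E where "E = (\<lambda>x. (u x)\<^sup>2 + (v x)\<^sup>2)"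
  have E_deriv: "(E has_real_derivative - (u x * v x) / (2 * x\<^sup>2)) (at x)" if "x > 0" for x
    unfolding E_def using that
    by (auto intro!: derivative_eq_intros u v simp: field_simps power2_eq_square)
  have uv: "\<bar>u x * v x\<bar> \<le> E x / 2" for x
    using sum_squares_bound [of "\<bar>u x\<bar>" "\<bar>v x\<bar>"] by (simp add: E_def abs_mult)
  \<comment> \<open>Since \<open>\<bar>E'\<bar> \<le> E / (4 x\<^sup>2)\<close>, the two products of \<open>E\<close> with \<open>exp (\<plusminus> 1 / (4 x))\<close> are monotone.\<close>
  have E_lower: "E 1 * exp (- 1 / (4 * 1)) \<le> E x * exp (- 1 / (4 * x))" if "x \<ge> 1" for x
  proof (rule DERIV_nonneg_imp_nondecreasing [OF that])
    fix t :: real assume t: "1 \<le> t" "t \<le> x"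
    have "((\<lambda>x. E x * exp (- 1 / (4 * x))) has_real_derivative
        exp (- 1 / (4 * t)) * ((E t / 2 - u t * v t) / (2 * t\<^sup>2))) (at t)"
      using t by (auto intro!: derivative_eq_intros E_deriv simp: field_simps power2_eq_square)
    moreover have "0 \<le> exp (- 1 / (4 * t)) * ((E t / 2 - u t * v t) / (2 * t\<^sup>2))"
      using uv [of t] by simp
    ultimately show "\<exists>d. ((\<lambda>x. E x * exp (- 1 / (4 * x))) has_real_derivative d) (at t) \<and> 0 \<le> d"
      by blast
  qed
  have E_upper: "E x * exp (1 / (4 * x)) \<le> E 1 * exp (1 / (4 * 1))" if "x \<ge> 1" for x
  proof (rule DERIV_nonpos_imp_nonincreasing [OF that])
    fix t :: real assume t: "1 \<le> t" "t \<le> x"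
    have "((\<lambda>x. E x * exp (1 / (4 * x))) has_real_derivative
        - (exp (1 / (4 * t)) * ((E t / 2 + u t * v t) / (2 * t\<^sup>2)))) (at t)"
      using t by (auto intro!: derivative_eq_intros E_deriv simp: field_simps power2_eq_square)
    moreover have "- (exp (1 / (4 * t)) * ((E t / 2 + u t * v t) / (2 * t\<^sup>2))) \<le> 0"
      using uv [of t] by simp
    ultimately show "\<exists>d. ((\<lambda>x. E x * exp (1 / (4 * x))) has_real_derivative d) (at t) \<and> d \<le> 0"
      by blast
  qed
  have E1: "E 1 > 0"
    using pos [of 1] by (simp add: E_def add_pos_nonneg)
  have E_pos: "E x > 0" if "x > 0" for x
  proof (cases "x \<le> 1")
    case True
    then show ?thesis using pos [of x] that by (simp add: E_def add_pos_nonneg)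
  next
    case False
    have "0 < E 1 * exp (- 1 / (4 * 1))" using E1 by simp
    also have "\<dots> \<le> E x * exp (- 1 / (4 * x))" using False by (intro E_lower) simp
    finally show ?thesis by (simp add: zero_less_mult_iff)
  qed
  have E_le: "E x \<le> E 1 * exp (1 / 4)" if "x \<ge> 1" for x
  proof -
    have "E x * 1 \<le> E x * exp (1 / (4 * x))"
      using that E_pos [of x] by (intro mult_left_mono) auto
    then show ?thesis using E_upper [OF that] by simp
  qed

  define r where "r = (\<lambda>x. sqrt (E x))"
  define r' where "r' = (\<lambda>x. - (u x * v x) / (4 * x\<^sup>2 * r x))"
  \<comment> \<open>The angular speed of \<open>(u, v)\<close> exceeds \<open>1\<close> by \<open>q\<close>.\<close>
  define q where "q = (\<lambda>x. (u x)\<^sup>2 / (4 * x\<^sup>2 * E x))"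
  have r_pos: "r x > 0" if "x > 0" for x
    using E_pos [OF that] by (simp add: r_def)
  have r2: "r x * r x = E x" if "x > 0" for x
    using E_pos [OF that] by (simp add: r_def)
  have r_deriv: "(r has_real_derivative r' x) (at x)" if "x > 0" for x
    unfolding r_def using that E_pos [OF that]
    by (auto intro!: derivative_eq_intros E_deriv simp: r'_def r_def field_simps)
  define K where "K = sqrt (E 1 * exp (1 / 4)) / 8"
  have r'_bound: "\<bar>r' x\<bar> \<le> K / x\<^sup>2" if "x \<ge> 1" for x
  proof -
    have x: "x > 0" using that by simp
    have "\<bar>r' x\<bar> = \<bar>u x * v x\<bar> / (4 * x\<^sup>2 * r x)"
      using r_pos [OF x] by (simp add: r'_def abs_mult)
    also have "\<dots> \<le> (r x * r x / 2) / (4 * x\<^sup>2 * r x)"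
      using uv [of x] r_pos [OF x] by (intro divide_right_mono) (auto simp: r2 [OF x])
    also have "\<dots> = r x / 8 / x\<^sup>2"
      using r_pos [OF x] by (simp add: field_simps)
    also have "\<dots> \<le> K / x\<^sup>2"
      unfolding K_def r_def using E_le [OF that] by (intro divide_right_mono) auto
    finally show ?thesis .
  qed
  have q_bound: "0 \<le> q x \<and> q x \<le> 1 / (4 * x\<^sup>2)" if "x > 0" for x
  proof -
    have "(u x)\<^sup>2 / E x \<le> 1"
      using E_pos [OF that] by (simp add: E_def)
    then have "(u x)\<^sup>2 / E x / (4 * x\<^sup>2) \<le> 1 / (4 * x\<^sup>2)"
      by (intro divide_right_mono) auto
    then show ?thesis
      using E_pos [OF that] by (auto simp: q_def mult.commute)
  qed

  define \<theta>\<^sub>0 where "\<theta>\<^sub>0 = arctan (- v 1 / u 1)"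
  \<comment> \<open>Starting the integral at \<open>1 / 2\<close> makes the derivative at \<open>x = 1\<close> two-sided.\<close>
  define \<theta> where "\<theta> = (\<lambda>x. \<theta>\<^sub>0 + (x - 1) + (integral {1/2..x} q - integral {1/2..1} q))"
  have cont: "continuous_on {1/2..b} q" for b :: real
  proof -
    have "continuous_on {1/2..b} u" "continuous_on {1/2..b} v" "continuous_on {1/2..b} E"
      by (intro DERIV_continuous_on [OF has_field_derivative_at_within], (rule u v E_deriv), simp)+
    moreover have "4 * x\<^sup>2 * E x \<noteq> 0" if "x \<in> {1/2..b}" for x
      using E_pos [of x] that by simp
    ultimately show ?thesis
      unfolding q_def by (intro continuous_intros) auto
  qed
  have \<theta>_deriv: "(\<theta> has_real_derivative 1 + q x) (at x)" if "x \<ge> 1" for x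
  proof -
    have "((\<lambda>x. integral {1/2..x} q) has_real_derivative q x) (at x within {1/2..x+1})"
      using that by (intro integral_has_real_derivative cont) auto
    moreover have "at x within {1/2..x+1} = at x"
      using that by (intro at_within_interior) auto
    ultimately have "((\<lambda>x. integral {1/2..x} q) has_real_derivative q x) (at x)"
      by simp
    then show ?thesis
      unfolding \<theta>_def by (auto intro!: derivative_eq_intros)
  qed
  have \<theta>1: "\<theta> 1 = \<theta>\<^sub>0" by (simp add: \<theta>_def)

  \<comment> \<open>The components of \<open>(u, v)\<close> in the rotating frame, divided by \<open>r\<close>, are constant.\<close>
  define p where "p = (\<lambda>x. (u x * cos (\<theta> x) - v x * sin (\<theta> x)) / r x)"
  define s where "s = (\<lambda>x. (u x * sin (\<theta> x) + v x * cos (\<theta> x)) / r x)"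
  have relations: "1 + q x = (E x + (u x)\<^sup>2 / (4 * x\<^sup>2)) / E x"
    "r' x / r x = - (u x * v x) / (4 * x\<^sup>2 * E x)" if "x \<ge> 1" for x
    using that E_pos [of x] r_pos [of x] r2 [of x]
    by (auto simp: q_def r'_def field_simps)
  have quot: "((\<lambda>x. f x / r x) has_real_derivative (f' - f x * (r' x / r x)) / r x) (at x)"
    if "x \<ge> 1" "(f has_real_derivative f') (at x)" for f f' x
    using that r_pos [of x]
    by (auto intro!: derivative_eq_intros r_deriv simp: field_simps)
  have p_deriv: "(p has_real_derivative 0) (at x)" if "x \<ge> 1" for x
  proof -
    have x: "x > 0" using that by simp
    let ?c = "cos (\<theta> x)" and ?s = "sin (\<theta> x)"
    let ?d = "v x * ?c - u x * (?s * (1 + q x)) - (- (1 + 1 / (4 * x\<^sup>2)) * u x * ?s + v x * (?c * (1 + q x)))"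
    have "((\<lambda>x. u x * cos (\<theta> x) - v x * sin (\<theta> x)) has_real_derivative ?d) (at x)"
      using x that by (auto intro!: derivative_eq_intros u v \<theta>_deriv)
    from quot [OF that this]
    have "(p has_real_derivative (?d - (u x * ?c - v x * ?s) * (r' x / r x)) / r x) (at x)"
      by (simp add: p_def)
    moreover have "?d - (u x * ?c - v x * ?s) * (r' x / r x) = 0"
      unfolding relations [OF that] using x E_pos [OF x]
      by (simp add: divide_simps) (simp add: E_def algebra_simps power2_eq_square)
    ultimately show ?thesis by simp
  qed
  have s_deriv: "(s has_real_derivative 0) (at x)" if "x \<ge> 1" for x
  proof -
    have x: "x > 0" using that by simp
    let ?c = "cos (\<theta> x)" and ?s = "sin (\<theta> x)"
    let ?d = "v x * ?s + u x * (?c * (1 + q x)) + (- (1 + 1 / (4 * x\<^sup>2)) * u x * ?c - v x * (?s * (1 + q x)))"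
    have "((\<lambda>x. u x * sin (\<theta> x) + v x * cos (\<theta> x)) has_real_derivative ?d) (at x)"
      using x that by (auto intro!: derivative_eq_intros u v \<theta>_deriv)
    from quot [OF that this]
    have "(s has_real_derivative (?d - (u x * ?s + v x * ?c) * (r' x / r x)) / r x) (at x)"
      by (simp add: s_def)
    moreover have "?d - (u x * ?s + v x * ?c) * (r' x / r x) = 0"
      unfolding relations [OF that] using x E_pos [OF x]
      by (simp add: divide_simps) (simp add: E_def algebra_simps power2_eq_square)
    ultimately show ?thesis by simp
  qed
  have const: "f x = f 1" if "x \<ge> 1" "\<And>x. x \<ge> 1 \<Longrightarrow> (f has_real_derivative 0) (at x)"
    for f and x :: real
    using that DERIV_atLeastAtMost_imp_continuous_on [of 1 x f] DERIV_isconst_end [of 1 x f]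
    by (cases "x = 1") fastforce+
  have u1: "u 1 > 0" using pos [of 1] by simp
  have sqrt_eq: "sqrt (1 + (- v 1 / u 1)\<^sup>2) = r 1 / u 1"
  proof -
    have "1 + (- v 1 / u 1)\<^sup>2 = E 1 / (u 1)\<^sup>2"
      using u1 by (simp add: E_def power_divide add_divide_distrib)
    then show ?thesis using u1 by (simp add: r_def real_sqrt_divide)
  qed
  have c0: "cos \<theta>\<^sub>0 = u 1 / r 1" and s0: "sin \<theta>\<^sub>0 = - v 1 / r 1"
    unfolding \<theta>\<^sub>0_def cos_arctan sin_arctan sqrt_eq using u1 r_pos [of 1] by (auto simp: field_simps)
  have "p 1 = (u 1 * u 1 + v 1 * v 1) / (r 1 * r 1)"
    unfolding p_def \<theta>1 c0 s0 using r_pos [of 1] by (simp add: field_simps)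
  also have "\<dots> = 1"
    using E_pos [of 1] by (simp add: r2) (simp add: E_def power2_eq_square)
  finally have p: "p x = 1" if "x \<ge> 1" for x
    using const [OF that p_deriv] by simp
  have "s 1 = 0"
    unfolding s_def \<theta>1 c0 s0 by simp
  then have s: "s x = 0" if "x \<ge> 1" for x
    using const [OF that s_deriv] by simp
  have polar: "u x = r x * cos (\<theta> x) \<and> v x = - r x * sin (\<theta> x)" if "x \<ge> 1" for x
  proof -
    let ?c = "cos (\<theta> x)" and ?s = "sin (\<theta> x)"
    have P: "u x * ?c - v x * ?s = r x" and S: "u x * ?s + v x * ?c = 0"
      using p [OF that] s [OF that] r_pos [of x] that by (auto simp: p_def s_def field_simps)
    have one: "?c * ?c + ?s * ?s = 1"
      using sin_cos_squared_add3 [of "\<theta> x"] by simp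
    have rotate: "a * (c * c + s * s) = (a * c - b * s) * c + (a * s + b * c) * s"
      "b * (c * c + s * s) = - (a * c - b * s) * s + (a * s + b * c) * c" for a b c s :: real
      by (simp_all add: algebra_simps)
    show ?thesis
      using rotate [where a = "u x" and b = "v x" and c = ?c and s = ?s] unfolding one P S by simp
  qed
  show ?thesis
  proof (rule that [of r \<theta> r' K q])
    show "- (pi / 2) < \<theta> 1" "\<theta> 1 < pi / 2"
      unfolding \<theta>1 \<theta>\<^sub>0_def using arctan_bounded [of "- v 1 / u 1"] by auto
  qed (use polar r_pos r_deriv r'_bound q_bound \<theta>_deriv in auto)
qed

section \<open>Zeros and asymptotics of the Bessel function of order zero\<close>

lemma abs_cos_diff_le: "\<bar>cos x - cos y\<bar> \<le> \<bar>x - y\<bar>" for x y :: real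
proof -
  have "\<bar>cos x - cos y\<bar> = 2 * \<bar>sin ((x + y) / 2)\<bar> * \<bar>sin ((y - x) / 2)\<bar>"
    by (simp add: cos_diff_cos abs_mult)
  also have "\<dots> \<le> 2 * 1 * \<bar>(y - x) / 2\<bar>"
    by (intro mult_mono abs_sin_x_le_abs_x) auto
  finally show ?thesis by simp
qed

text \<open>
  The Pruefer variables of \<open>u x = x\<^bsup>1/2\<^esup> J\<^sub>0 x\<close>.  The estimates start at \<open>x = 1\<close>, where the
  bound \<open>1 + 1 / (4 x\<^sup>2) \<le> 5 / 4\<close> on the angular speed holds; the last one extends to all \<open>x > 0\<close>
  since \<open>u\<close> is bounded on \<open>[0, 1]\<close> and \<open>1 / x \<ge> 1\<close> there.
\<close>

lemma bessel_J0_phase: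
  obtains \<theta> :: "real \<Rightarrow> real" and L C R :: real where
    "\<And>b. continuous_on {1..b} \<theta>"
    "\<And>x y. 1 \<le> x \<Longrightarrow> x \<le> y \<Longrightarrow> y - x \<le> \<theta> y - \<theta> x \<and> \<theta> y - \<theta> x \<le> 5 / 4 * (y - x)"
    "- (pi / 2) < \<theta> 1" "\<theta> 1 < pi / 2"
    "\<And>x. x \<ge> 1 \<Longrightarrow> bessel_J 0 x = 0 \<longleftrightarrow> cos (\<theta> x) = 0"
    "\<And>x. x \<ge> 1 \<Longrightarrow> bessel_J 0 x = 0 \<Longrightarrow> bessel_J 1 x \<noteq> 0"
    "\<And>x. x \<ge> 1 \<Longrightarrow> \<bar>\<theta> x - x - L\<bar> \<le> C / x"
    "\<And>x. x > 0 \<Longrightarrow> \<bar>sqrt x * bessel_J 0 x - R * cos (x + L)\<bar> \<le> C / x"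
proof -
  define u where "u = (\<lambda>x. sqrt x * bessel_J 0 x)"
  define v where "v = (\<lambda>x. bessel_J 0 x / (2 * sqrt x) - sqrt x * bessel_J 1 x)"
  have u: "(u has_real_derivative v x) (at x)" if "x > 0" for x
    unfolding u_def v_def using that
    by (auto intro!: derivative_eq_intros simp del: One_nat_def simp: field_simps)
  have v: "(v has_real_derivative - (1 + 1 / (4 * x\<^sup>2)) * u x) (at x)" if x: "x > 0" for x
  proof -
    define s where "s = sqrt x"
    have s: "s > 0" "x = s * s" using x by (auto simp: s_def)
    have "(v has_real_derivative
      (- bessel_J 1 x * (2 * s) - bessel_J 0 x * (2 * (1 / (2 * s)))) / (2 * s)\<^sup>2
      - (1 / (2 * s) * bessel_J 1 x + s * (bessel_J 0 x - bessel_J 1 x / x))) (at x)"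
      unfolding v_def s_def using x
      by (auto intro!: derivative_eq_intros simp del: One_nat_def
               simp: power2_eq_square inverse_eq_divide)
    also have "(- bessel_J 1 x * (2 * s) - bessel_J 0 x * (2 * (1 / (2 * s)))) / (2 * s)\<^sup>2
      - (1 / (2 * s) * bessel_J 1 x + s * (bessel_J 0 x - bessel_J 1 x / x))
      = - (1 + 1 / (4 * x\<^sup>2)) * (s * bessel_J 0 x)"
      using s(1) unfolding s(2) by (simp add: field_simps power2_eq_square)
    finally show ?thesis
      by (simp add: u_def s_def)
  qed
  have pos: "u x > 0" if "0 < x" "x \<le> 1" for x
    using that bessel_J0_pos [of x] by (simp add: u_def)
  obtain r \<theta> r' K q where
    r_pos: "\<And>x. x \<ge> 1 \<Longrightarrow> r x > 0" and
    polar_u: "\<And>x. x \<ge> 1 \<Longrightarrow> u x = r x * cos (\<theta> x)" and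
    polar_v: "\<And>x. x \<ge> 1 \<Longrightarrow> v x = - r x * sin (\<theta> x)" and
    r_deriv: "\<And>x. x \<ge> 1 \<Longrightarrow> (r has_real_derivative r' x) (at x)" and
    r'_bound: "\<And>x. x \<ge> 1 \<Longrightarrow> \<bar>r' x\<bar> \<le> K / x\<^sup>2" and
    \<theta>_deriv: "\<And>x. x \<ge> 1 \<Longrightarrow> (\<theta> has_real_derivative 1 + q x) (at x)" and
    q_bound: "\<And>x. x \<ge> 1 \<Longrightarrow> 0 \<le> q x \<and> q x \<le> 1 / (4 * x\<^sup>2)" and
    \<theta>1: "- (pi / 2) < \<theta> 1" "\<theta> 1 < pi / 2"
    by (rule pruefer_variables [OF u v pos]) blast+
  obtain R where R: "\<And>x. x \<ge> 1 \<Longrightarrow> \<bar>r x - R\<bar> \<le> K / x"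
    by (rule limit_with_rate_of_derivative_bound [OF r_deriv r'_bound]) blast+
  obtain L where L: "\<And>x. x \<ge> 1 \<Longrightarrow> \<bar>(\<theta> x - x) - L\<bar> \<le> (1 / 4) / x"
  proof (rule limit_with_rate_of_derivative_bound)
    show "((\<lambda>x. \<theta> x - x) has_real_derivative q x) (at x)" if "x \<ge> 1" for x
      using that by (auto intro!: derivative_eq_intros \<theta>_deriv)
    show "\<bar>q x\<bar> \<le> (1 / 4) / x\<^sup>2" if "x \<ge> 1" for x
      using q_bound [OF that] by simp
  qed blast
  have "compact ((\<lambda>x. sqrt x * bessel_J 0 x) ` {0..1})"
    by (intro compact_continuous_image continuous_intros) simp_all
  then obtain B where B: "\<And>x. 0 \<le> x \<Longrightarrow> x \<le> 1 \<Longrightarrow> \<bar>sqrt x * bessel_J 0 x\<bar> \<le> B"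
    by (force dest!: compact_imp_bounded simp: bounded_iff)
  have K: "K \<ge> 0" using R [of 1] by simp
  define C where "C = K + \<bar>R\<bar> + \<bar>B\<bar> + 1"
  have C: "1 / 4 \<le> C" "K + \<bar>R\<bar> \<le> C" "B + \<bar>R\<bar> \<le> C" "0 \<le> C"
    using K by (auto simp: C_def)
  show ?thesis
  proof (rule that [of \<theta> L C R])
    show "continuous_on {1..b} \<theta>" for b
      by (intro DERIV_continuous_on [OF has_field_derivative_at_within]) (rule \<theta>_deriv, simp)
    show "y - x \<le> \<theta> y - \<theta> x \<and> \<theta> y - \<theta> x \<le> 5 / 4 * (y - x)" if "1 \<le> x" "x \<le> y" for x y
    proof
      have "\<theta> x - x \<le> \<theta> y - y"
      proof (rule DERIV_nonneg_imp_nondecreasing [OF that(2)])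
        fix t assume "x \<le> t" "t \<le> y"
        then have t: "t \<ge> 1" using that by simp
        show "\<exists>d. ((\<lambda>x. \<theta> x - x) has_real_derivative d) (at t) \<and> 0 \<le> d"
          using q_bound [OF t] t by (intro exI [of _ "q t"]) (auto intro!: derivative_eq_intros \<theta>_deriv)
      qed
      then show "y - x \<le> \<theta> y - \<theta> x" by simp
      have "\<theta> y - 5 / 4 * y \<le> \<theta> x - 5 / 4 * x"
      proof (rule DERIV_nonpos_imp_nonincreasing [OF that(2)])
        fix t assume "x \<le> t" "t \<le> y"
        then have t: "t \<ge> 1" using that by simp
        then have "1 / (4 * t\<^sup>2) \<le> 1 / 4"
          by (simp add: field_simps one_le_power)
        then have "q t \<le> 1 / 4"
          using q_bound [OF t] by linarith
        then show "\<exists>d. ((\<lambda>x. \<theta> x - 5 / 4 * x) has_real_derivative d) (at t) \<and> d \<le> 0"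
          using t by (intro exI [of _ "1 + q t - 5 / 4"]) (auto intro!: derivative_eq_intros \<theta>_deriv)
      qed
      then show "\<theta> y - \<theta> x \<le> 5 / 4 * (y - x)" by simp
    qed
    show "bessel_J 0 x = 0 \<longleftrightarrow> cos (\<theta> x) = 0" if "x \<ge> 1" for x
      using polar_u [OF that] r_pos [OF that] that by (auto simp: u_def)
    show "bessel_J 1 x \<noteq> 0" if "x \<ge> 1" "bessel_J 0 x = 0" for x
    proof
      assume "bessel_J 1 x = 0"
      then have "u x = 0" "v x = 0" using that by (simp_all add: u_def v_def)
      then have "cos (\<theta> x) = 0" "sin (\<theta> x) = 0"
        using polar_u [of x] polar_v [of x] r_pos [of x] that by auto
      then show False using sin_cos_squared_add [of "\<theta> x"] by simp
    qed
    show "\<bar>\<theta> x - x - L\<bar> \<le> C / x" if "x \<ge> 1" for x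
    proof -
      have "(1 / 4) / x \<le> C / x" using C that by (intro divide_right_mono) auto
      then show ?thesis using L [OF that] by linarith
    qed
    show "\<bar>sqrt x * bessel_J 0 x - R * cos (x + L)\<bar> \<le> C / x" if x: "x > 0" for x
    proof (cases "x \<ge> 1")
      case True
      have "sqrt x * bessel_J 0 x - R * cos (x + L)
          = (r x - R) * cos (\<theta> x) + R * (cos (\<theta> x) - cos (x + L))"
        using polar_u [OF True] by (simp add: u_def algebra_simps)
      also have "\<bar>\<dots>\<bar> \<le> \<bar>r x - R\<bar> * \<bar>cos (\<theta> x)\<bar> + \<bar>R\<bar> * \<bar>cos (\<theta> x) - cos (x + L)\<bar>"
        unfolding abs_mult [symmetric] by (rule abs_triangle_ineq)
      also have "\<dots> \<le> \<bar>r x - R\<bar> * 1 + \<bar>R\<bar> * \<bar>\<theta> x - (x + L)\<bar>"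
        by (intro add_mono mult_left_mono abs_cos_diff_le) auto
      also have "\<dots> \<le> K / x + \<bar>R\<bar> * (1 / x)"
      proof (intro add_mono mult_left_mono)
        show "\<bar>r x - R\<bar> * 1 \<le> K / x" using R [OF True] by simp
        have "(1 / 4) / x \<le> 1 / x" using x by (intro divide_right_mono) auto
        then show "\<bar>\<theta> x - (x + L)\<bar> \<le> 1 / x" using L [OF True] by (simp add: algebra_simps)
      qed auto
      also have "\<dots> = (K + \<bar>R\<bar>) / x" by (simp add: add_divide_distrib)
      also have "\<dots> \<le> C / x" using C x by (intro divide_right_mono) auto
      finally show ?thesis .
    next
      case False
      have "\<bar>sqrt x * bessel_J 0 x - R * cos (x + L)\<bar>
          \<le> \<bar>sqrt x * bessel_J 0 x\<bar> + \<bar>R\<bar> * \<bar>cos (x + L)\<bar>"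
        unfolding abs_mult [of R, symmetric] by (rule abs_triangle_ineq4)
      also have "\<dots> \<le> B + \<bar>R\<bar> * 1"
        using B [of x] x False by (intro add_mono mult_left_mono) auto
      also have "\<dots> \<le> C" using C by simp
      also have "\<dots> \<le> C / x"
        using C x False by (simp add: field_simps mult_left_le)
      finally show ?thesis .
    qed
  qed (use \<theta>1 in auto)
qed

lemma bessel_J0_zero_eq_enumeration:
  assumes mono: "strict_mono \<tau>" and range: "range \<tau> = {y. 0 < y \<and> bessel_J 0 y = 0}"
  shows "bessel_J0_zero (Suc n) = \<tau> n"
proof -
  have zero: "0 < \<tau> k \<and> bessel_J 0 (\<tau> k) = 0" for k
    using range by auto
  have card: "card {y. 0 < y \<and> y \<le> \<tau> k \<and> bessel_J 0 y = 0} = Suc k" for k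
  proof -
    have "{y. 0 < y \<and> y \<le> \<tau> k \<and> bessel_J 0 y = 0} = {y \<in> range \<tau>. y \<le> \<tau> k}"
      unfolding range by auto
    also have "\<dots> = \<tau> ` {..k}"
      using strict_mono_less_eq [OF mono] by auto
    finally show ?thesis
      using strict_mono_on_imp_inj_on [OF mono] by (simp add: card_image inj_on_subset)
  qed
  show ?thesis
    unfolding bessel_J0_zero_def
  proof (rule the_equality)
    show "0 < \<tau> n \<and> bessel_J 0 (\<tau> n) = 0 \<and>
        card {y. 0 < y \<and> y \<le> \<tau> n \<and> bessel_J 0 y = 0} = Suc n"
      using zero card by blast
    fix x
    assume x: "0 < x \<and> bessel_J 0 x = 0 \<and>
        card {y. 0 < y \<and> y \<le> x \<and> bessel_J 0 y = 0} = Suc n"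
    then obtain k where "x = \<tau> k" using range by blast
    then show "x = \<tau> n" using x card [of k] by simp
  qed
qed

text \<open>
  Zeros of \<open>J\<^sub>0\<close> are the points where the phase \<open>\<theta>\<close> passes an odd multiple of \<open>\<pi> / 2\<close>.  As \<open>\<theta>\<close>
  increases strictly to infinity from a value in \<open>(- \<pi> / 2, \<pi> / 2)\<close>, each of
  \<open>\<pi> / 2, 3 \<pi> / 2, \<dots>\<close> is passed exactly once, which identifies the \<open>m\<close>-th zero by
  \<open>\<theta> j\<^sub>m = \<pi> m - \<pi> / 2\<close>.  Consecutive zeros are at least \<open>4 \<pi> / 5 > 1\<close> apart because \<open>\<theta>\<close> grows at
  a rate of at most \<open>5 / 4\<close>; this yields \<open>m \<le> j\<^sub>m\<close>.
\<close>

lemma bessel_J0_zeros: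
  obtains R L c C :: real where
    "\<And>m. m \<ge> 1 \<Longrightarrow> bessel_J 0 (bessel_J0_zero m) = 0"
    "\<And>m. m \<ge> 1 \<Longrightarrow> bessel_J 1 (bessel_J0_zero m) \<noteq> 0"
    "\<And>m. m \<ge> 1 \<Longrightarrow> real m \<le> bessel_J0_zero m"
    "\<And>m. m \<ge> 1 \<Longrightarrow> bessel_J0_zero m \<le> 5 * real m"
    "\<And>m n. m \<ge> 1 \<Longrightarrow> n \<ge> 1 \<Longrightarrow> bessel_J0_zero m = bessel_J0_zero n \<Longrightarrow> m = n"
    "\<And>m. m \<ge> 1 \<Longrightarrow> \<bar>bessel_J0_zero m - (pi * real m + c)\<bar> \<le> C / real m"
    "\<And>x. x > 0 \<Longrightarrow> \<bar>sqrt x * bessel_J 0 x - R * cos (x + L)\<bar> \<le> C / x"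
proof -
  obtain \<theta> L C R where
    cont: "\<And>b. continuous_on {1..b} \<theta>" and
    incr: "\<And>x y. 1 \<le> x \<Longrightarrow> x \<le> y \<Longrightarrow> y - x \<le> \<theta> y - \<theta> x \<and> \<theta> y - \<theta> x \<le> 5 / 4 * (y - x)" and
    \<theta>1: "- (pi / 2) < \<theta> 1" "\<theta> 1 < pi / 2" and
    zero_iff: "\<And>x. x \<ge> 1 \<Longrightarrow> bessel_J 0 x = 0 \<longleftrightarrow> cos (\<theta> x) = 0" and
    J1: "\<And>x. x \<ge> 1 \<Longrightarrow> bessel_J 0 x = 0 \<Longrightarrow> bessel_J 1 x \<noteq> 0" and
    L: "\<And>x. x \<ge> 1 \<Longrightarrow> \<bar>\<theta> x - x - L\<bar> \<le> C / x" and
    asymp: "\<And>x. x > 0 \<Longrightarrow> \<bar>sqrt x * bessel_J 0 x - R * cos (x + L)\<bar> \<le> C / x"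
    by (rule bessel_J0_phase) blast
  have "\<exists>x\<ge>1. \<theta> x = pi * real n + pi / 2" for n
  proof -
    let ?b = "1 + (pi * real n + pi / 2 - \<theta> 1)"
    have "0 \<le> pi * real n" by simp
    then have "0 \<le> pi * real n + pi / 2 - \<theta> 1"
      using \<theta>1(2) by linarith
    then have "\<theta> 1 \<le> pi * real n + pi / 2" "pi * real n + pi / 2 \<le> \<theta> ?b" "1 \<le> ?b"
      using incr [of 1 ?b] by auto
    then obtain x where "1 \<le> x" "\<theta> x = pi * real n + pi / 2"
      using IVT' [of \<theta> 1 _ ?b, OF _ _ _ cont] by blast
    then show ?thesis by blast
  qed
  then obtain \<tau> where \<tau>: "\<And>n. \<tau> n \<ge> 1" "\<And>n. \<theta> (\<tau> n) = pi * real n + pi / 2"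
    by metis
  have mono: "strict_mono \<tau>"
  proof (rule strict_monoI, rule ccontr)
    fix m n :: nat assume "m < n" "\<not> \<tau> m < \<tau> n"
    then have "\<theta> (\<tau> n) \<le> \<theta> (\<tau> m)" using incr [of "\<tau> n" "\<tau> m"] \<tau>(1) by fastforce
    then show False using \<open>m < n\<close> by (simp add: \<tau>)
  qed
  have range: "range \<tau> = {y. 0 < y \<and> bessel_J 0 y = 0}"
  proof (intro equalityI subsetI)
    fix y assume "y \<in> range \<tau>"
    then obtain n where y: "y = \<tau> n" by blast
    have "cos (pi * real n + pi / 2) = 0"
      by (simp add: cos_add)
    then show "y \<in> {y. 0 < y \<and> bessel_J 0 y = 0}"
      unfolding y using zero_iff [OF \<tau>(1)] \<tau>(1) [of n] by (simp add: \<tau>(2))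
  next
    fix y assume "y \<in> {y. 0 < y \<and> bessel_J 0 y = 0}"
    then have y: "0 < y" "bessel_J 0 y = 0" by auto
    then have "y > 1" using bessel_J0_pos [of y] by (cases "y \<le> 1") auto
    with y have "cos (\<theta> y) = 0" using zero_iff [of y] by simp
    then obtain i :: int where i: "\<theta> y = of_int i * pi + pi / 2"
      unfolding cos_zero_iff_int2 by auto
    have "\<theta> 1 \<le> \<theta> y" using incr [of 1 y] \<open>y > 1\<close> by auto
    then have "0 < (of_int i + 1) * pi" using \<theta>1(1) i by (simp add: algebra_simps)
    then have "0 < real_of_int i + 1" by (simp add: zero_less_mult_iff)
    then have "i \<ge> 0" by linarith
    then obtain n where n: "i = int n" using nonneg_int_cases by blast
    have "\<theta> y = \<theta> (\<tau> n)" by (simp add: i n \<tau>(2) mult.commute)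
    then have "y = \<tau> n"
      using incr [of y "\<tau> n"] incr [of "\<tau> n" y] \<tau>(1) [of n] \<open>y > 1\<close> by linarith
    then show "y \<in> range \<tau>" by blast
  qed
  have j: "bessel_J0_zero m = \<tau> (m - 1)" if "m \<ge> 1" for m
    using bessel_J0_zero_eq_enumeration [OF mono range, of "m - 1"] that by simp
  have lower: "real (Suc n) \<le> \<tau> n" for n
  proof (induction n)
    case (Suc n)
    have "pi = \<theta> (\<tau> (Suc n)) - \<theta> (\<tau> n)" by (simp add: \<tau> algebra_simps)
    also have "\<dots> \<le> 5 / 4 * (\<tau> (Suc n) - \<tau> n)"
      using incr [of "\<tau> n" "\<tau> (Suc n)"] \<tau>(1) strict_mono_less_eq [OF mono, of n "Suc n"] by simp
    finally show ?case using Suc pi_gt3 by simp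
  qed (use \<tau> in simp)
  have upper: "\<tau> n \<le> 5 * real (Suc n)" for n
  proof -
    have "\<tau> n - 1 \<le> \<theta> (\<tau> n) - \<theta> 1" using incr [of 1 "\<tau> n"] \<tau>(1) by simp
    then have "\<tau> n \<le> pi * real (Suc n) + 1"
      using \<theta>1 by (simp add: \<tau> algebra_simps)
    also have "\<dots> \<le> 4 * real (Suc n) + 1 * real (Suc n)"
      using pi_less_4 by (intro add_mono mult_right_mono) auto
    finally show ?thesis by simp
  qed
  show ?thesis
  proof (rule that [of "- (pi / 2) - L" C R L])
    fix m :: nat assume m: "m \<ge> 1"
    show "bessel_J 0 (bessel_J0_zero m) = 0"
      using range by (auto simp: j [OF m])
    then show "bessel_J 1 (bessel_J0_zero m) \<noteq> 0"
      using J1 \<tau>(1) by (simp add: j [OF m])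
    show "real m \<le> bessel_J0_zero m" "bessel_J0_zero m \<le> 5 * real m"
      using lower [of "m - 1"] upper [of "m - 1"] m by (auto simp: j)
    show "m = n" if "n \<ge> 1" "bessel_J0_zero m = bessel_J0_zero n" for n
      using that m strict_mono_eq [OF mono] by (simp add: j)
    have C: "0 \<le> C" using L [of 1] by simp
    have "\<theta> (\<tau> (m - 1)) = pi * real m - pi / 2"
      using m by (simp add: \<tau> of_nat_diff algebra_simps)
    then have "\<bar>bessel_J0_zero m - (pi * real m + (- (pi / 2) - L))\<bar> = \<bar>\<theta> (\<tau> (m - 1)) - \<tau> (m - 1) - L\<bar>"
      by (simp add: j [OF m])
    also have "\<dots> \<le> C / \<tau> (m - 1)" by (rule L [OF \<tau>(1)])
    also have "\<dots> \<le> C / real m"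
      using lower [of "m - 1"] m C by (intro divide_left_mono) auto
    finally show "\<bar>bessel_J0_zero m - (pi * real m + (- (pi / 2) - L))\<bar> \<le> C / real m" .
  qed (use asymp in auto)
qed

section \<open>Cosine sums with monotone coefficients\<close>

lemma abel_summation_bound:
  fixes c d :: "nat \<Rightarrow> real"
  assumes decr: "decseq d" and nonneg: "\<And>k. 0 \<le> d k"
    and bound: "\<And>n. \<bar>\<Sum>k<n. c k\<bar> \<le> B"
  shows "\<bar>\<Sum>k<n. d k * c k\<bar> \<le> d 0 * B"
proof -
  let ?S = "\<lambda>n. \<Sum>k<n. c k"
  have "(\<Sum>k<n. d k * c k) = d n * ?S n + (\<Sum>k<n. (d k - d (Suc k)) * ?S (Suc k))"
    by (induction n) (simp_all add: algebra_simps)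
  also have "\<bar>\<dots>\<bar> \<le> \<bar>d n * ?S n\<bar> + (\<Sum>k<n. \<bar>(d k - d (Suc k)) * ?S (Suc k)\<bar>)"
    by (intro order.trans [OF abs_triangle_ineq] add_left_mono sum_abs)
  also have "\<dots> \<le> d n * B + (\<Sum>k<n. (d k - d (Suc k)) * B)"
    using nonneg decseq_SucD [OF decr] bound
    by (intro add_mono sum_mono) (auto simp: abs_mult simp del: sum.lessThan_Suc intro!: mult_mono)
  also have "\<dots> = d 0 * B"
    unfolding sum_distrib_right [symmetric] sum_lessThan_telescope' by (simp add: algebra_simps)
  finally show ?thesis .
qed

text \<open>Multiplication by \<open>2 sin t\<close> makes the sum telescope.\<close>

lemma abs_sum_cos_arith_le:
  fixes t \<psi> :: real
  assumes "sin t \<noteq> 0"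
  shows "\<bar>\<Sum>k<n. cos (2 * real k * t + \<psi>)\<bar> \<le> 1 / \<bar>sin t\<bar>"
proof -
  have "2 * sin t * (\<Sum>k<n. cos (2 * real k * t + \<psi>)) = sin ((2 * real n - 1) * t + \<psi>) - sin (\<psi> - t)"
  proof (induction n)
    case (Suc n)
    let ?a = "2 * real n * t + \<psi>"
    have "(2 * real (Suc n) - 1) * t + \<psi> = ?a + t" "(2 * real n - 1) * t + \<psi> = ?a - t"
      by (simp_all add: algebra_simps)
    then have "sin ((2 * real (Suc n) - 1) * t + \<psi>) - sin ((2 * real n - 1) * t + \<psi>)
        = 2 * sin t * cos ?a"
      by (simp only: sin_add [of ?a t] sin_diff [of ?a t]) simp
    then show ?case using Suc by (simp add: distrib_left)
  qed (simp add: algebra_simps)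
  then have "2 * \<bar>sin t\<bar> * \<bar>\<Sum>k<n. cos (2 * real k * t + \<psi>)\<bar>
      = \<bar>sin ((2 * real n - 1) * t + \<psi>) - sin (\<psi> - t)\<bar>"
    by (metis abs_mult abs_numeral)
  also have "\<dots> \<le> 1 + 1"
    by (intro order.trans [OF abs_triangle_ineq4] add_mono) auto
  finally show ?thesis
    using assms by (simp add: field_simps)
qed

lemma abs_monotone_cos_block_le:
  fixes d :: "nat \<Rightarrow> real" and t \<psi> :: real
  assumes "decseq d" and "\<And>k. 0 \<le> d k" and "sin t \<noteq> 0"
  shows "\<bar>\<Sum>k=m..<n. d k * cos (2 * real k * t + \<psi>)\<bar> \<le> d m / \<bar>sin t\<bar>"
proof (cases "m \<le> n")
  case True
  have "(\<Sum>k=m..<n. d k * cos (2 * real k * t + \<psi>))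
      = (\<Sum>k<n-m. d (m + k) * cos (2 * real k * t + (2 * real m * t + \<psi>)))"
    using True
    by (intro sum.reindex_bij_witness [where i = "\<lambda>k. k + m" and j = "\<lambda>k. k - m"])
       (auto simp: of_nat_diff algebra_simps)
  also have "\<bar>\<dots>\<bar> \<le> d (m + 0) * (1 / \<bar>sin t\<bar>)"
    using assms by (intro abel_summation_bound abs_sum_cos_arith_le) (auto simp: decseq_def)
  finally show ?thesis by simp
next
  case False
  then show ?thesis using assms(2) by simp
qed

text \<open>
  The sum is compared with the integral of \<open>x\<^bsup>-\<gamma>\<^esup>\<close>, one mean value at a time.
\<close>

lemma sum_powr_minus_le:
  fixes \<gamma> :: real
  assumes "0 \<le> \<gamma>" "\<gamma> < 1"
  shows "(\<Sum>k<n. real (Suc k) powr - \<gamma>) \<le> real n powr (1 - \<gamma>) / (1 - \<gamma>)"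
proof (induction n)
  case (Suc n)
  have "(1 - \<gamma>) * real (Suc n) powr - \<gamma> \<le> real (Suc n) powr (1 - \<gamma>) - real n powr (1 - \<gamma>)"
  proof (cases "n = 0")
    case False
    have "\<exists>z>real n. z < real (Suc n) \<and> real (Suc n) powr (1 - \<gamma>) - real n powr (1 - \<gamma>)
        = (real (Suc n) - real n) * ((1 - \<gamma>) * z powr - \<gamma>)"
    proof (intro MVT2)
      fix x assume "real n \<le> x"
      then show "((\<lambda>x. x powr (1 - \<gamma>)) has_real_derivative (1 - \<gamma>) * x powr - \<gamma>) (at x)"
        using has_real_derivative_powr [of x "1 - \<gamma>"] False by simp
    qed simp
    then obtain z where z: "real n < z" "z < real (Suc n)"
      "real (Suc n) powr (1 - \<gamma>) - real n powr (1 - \<gamma>) = (1 - \<gamma>) * z powr - \<gamma>"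
      by auto
    have "real (Suc n) powr - \<gamma> \<le> z powr - \<gamma>"
      using z assms False by (intro powr_mono2') auto
    then show ?thesis
      using z(3) assms by (simp add: mult_left_mono)
  qed (use assms in simp)
  then show ?case
    using Suc assms by (simp add: field_simps)
qed simp

text \<open>
  The cut at \<open>M \<approx> 1 / \<bar>sin t\<bar>\<close> balances the two available estimates: the first \<open>M\<close> terms are bounded
  by their absolute values, the others by summation by parts, and both contribute the order
  \<open>\<bar>sin t\<bar>\<^bsup>\<gamma>-1\<^esup>\<close>.
\<close>

lemma abs_monotone_cos_sum_le:
  fixes d :: "nat \<Rightarrow> real" and t \<psi> \<gamma> A :: real
  assumes \<gamma>: "0 \<le> \<gamma>" "\<gamma> < 1" and decr: "decseq d" and nonneg: "\<And>k. 0 \<le> d k"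
    and upper: "\<And>k. d k \<le> A * real (Suc k) powr - \<gamma>" and sin: "sin t \<noteq> 0"
  shows "\<bar>\<Sum>k<n. d k * cos (2 * real k * t + \<psi>)\<bar> \<le> A * (2 / (1 - \<gamma>) + 1) * \<bar>sin t\<bar> powr (\<gamma> - 1)"
proof -
  define s where "s = \<bar>sin t\<bar>"
  have s: "0 < s" "s \<le> 1" using sin by (auto simp: s_def)
  define M where "M = nat \<lceil>1 / s\<rceil>"
  have M: "1 / s \<le> real M" "real M \<le> 2 / s"
  proof -
    have "1 \<le> 1 / s" using s by simp
    then have "real M = of_int \<lceil>1 / s\<rceil>" by (simp add: M_def)
    then show "1 / s \<le> real M" "real M \<le> 2 / s"
      using \<open>1 \<le> 1 / s\<close> ceiling_correct [of "1 / s"] by (auto simp: field_simps)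
  qed
  have A: "0 \<le> A" using upper [of 0] nonneg [of 0] by simp
  have head: "\<bar>\<Sum>k<m. d k * cos (2 * real k * t + \<psi>)\<bar> \<le> A * (2 / (1 - \<gamma>)) * s powr (\<gamma> - 1)" if "m \<le> M" for m
  proof -
    have "\<bar>\<Sum>k<m. d k * cos (2 * real k * t + \<psi>)\<bar> \<le> (\<Sum>k<m. A * real (Suc k) powr - \<gamma>)"
    proof (intro order.trans [OF sum_abs] sum_mono)
      fix k
      have "\<bar>d k * cos (2 * real k * t + \<psi>)\<bar> \<le> d k * 1"
        unfolding abs_mult using nonneg by (intro mult_mono) auto
      then show "\<bar>d k * cos (2 * real k * t + \<psi>)\<bar> \<le> A * real (Suc k) powr - \<gamma>"
        using upper [of k] by simp
    qed
    also have "\<dots> \<le> A * (real m powr (1 - \<gamma>) / (1 - \<gamma>))"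
      unfolding sum_distrib_left [symmetric] using \<gamma> A by (intro mult_left_mono sum_powr_minus_le)
    also have "\<dots> \<le> A * ((2 / s) powr (1 - \<gamma>) / (1 - \<gamma>))"
      using \<gamma> A M that by (intro mult_left_mono divide_right_mono powr_mono2) auto
    also have "(2 / s) powr (1 - \<gamma>) = 2 powr (1 - \<gamma>) * s powr (\<gamma> - 1)"
      using s by (simp add: powr_divide powr_diff powr_minus field_simps)
    also have "2 powr (1 - \<gamma>) \<le> (2::real) powr 1"
      using \<gamma> by (intro powr_mono) auto
    finally show ?thesis
      using A \<gamma> by (simp add: mult_left_mono mult_right_mono divide_right_mono)
  qed
  show ?thesis
  proof (cases "n \<le> M")
    case True
    have "A * (2 / (1 - \<gamma>)) * s powr (\<gamma> - 1) \<le> A * (2 / (1 - \<gamma>) + 1) * s powr (\<gamma> - 1)"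
      using A by (intro mult_right_mono mult_left_mono) auto
    then show ?thesis using head [OF True] by (simp add: s_def)
  next
    case False
    have "d M / s \<le> A * (1 / s) powr - \<gamma> / s"
    proof (intro divide_right_mono order.trans [OF upper] mult_left_mono)
      show "real (Suc M) powr - \<gamma> \<le> (1 / s) powr - \<gamma>"
        using M s \<gamma> by (intro powr_mono2') auto
    qed (use A s in auto)
    also have "\<dots> = A * s powr (\<gamma> - 1)"
      using s by (simp add: powr_divide powr_diff powr_minus field_simps)
    finally have tail: "\<bar>\<Sum>k=M..<n. d k * cos (2 * real k * t + \<psi>)\<bar> \<le> A * s powr (\<gamma> - 1)"
      using abs_monotone_cos_block_le [OF decr nonneg sin, where m = M and n = n and \<psi> = \<psi>] by (simp add: s_def)
    have "(\<Sum>k<n. d k * cos (2 * real k * t + \<psi>))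
        = (\<Sum>k<M. d k * cos (2 * real k * t + \<psi>)) + (\<Sum>k=M..<n. d k * cos (2 * real k * t + \<psi>))"
      using False sum.atLeastLessThan_concat [of 0 M n "\<lambda>k. d k * cos (2 * real k * t + \<psi>)"]
      by (simp add: lessThan_atLeast0)
    then have "\<bar>\<Sum>k<n. d k * cos (2 * real k * t + \<psi>)\<bar>
        \<le> A * (2 / (1 - \<gamma>)) * s powr (\<gamma> - 1) + A * s powr (\<gamma> - 1)"
      using head [of M] tail by linarith
    then show ?thesis
      by (simp add: s_def algebra_simps)
  qed
qed

lemma summable_monotone_cos:
  fixes d :: "nat \<Rightarrow> real" and t \<psi> :: real
  assumes decr: "decseq d" and nonneg: "\<And>k. 0 \<le> d k" and lim: "d \<longlonglongrightarrow> 0" and sin: "sin t \<noteq> 0"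
  shows "summable (\<lambda>k. d k * cos (2 * real k * t + \<psi>))"
  unfolding summable_Cauchy
proof (intro allI impI)
  fix e :: real assume "e > 0"
  have "(\<lambda>m. d m / \<bar>sin t\<bar>) \<longlonglongrightarrow> 0 / \<bar>sin t\<bar>"
    using sin by (intro tendsto_intros lim) auto
  then have "\<forall>\<^sub>F m in sequentially. d m / \<bar>sin t\<bar> < e"
    using \<open>e > 0\<close> by (intro order_tendstoD) auto
  then obtain N where N: "\<And>m. m \<ge> N \<Longrightarrow> d m / \<bar>sin t\<bar> < e"
    by (auto simp: eventually_sequentially)
  show "\<exists>N. \<forall>m\<ge>N. \<forall>n. norm (\<Sum>k=m..<n. d k * cos (2 * real k * t + \<psi>)) < e"
    using le_less_trans [OF abs_monotone_cos_block_le [OF decr nonneg sin] N] by auto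
qed

text \<open>
  The cubic Taylor estimate suffices, because \<open>\<pi> x \<le> 2\<close> makes the remainder at most two thirds of
  the linear term.
\<close>

lemma sin_pi_times_ge:
  fixes x :: real
  assumes "0 \<le> x" "x \<le> 1 / 2"
  shows "x \<le> sin (pi * x)"
proof -
  let ?y = "pi * x"
  have y: "0 \<le> ?y" "?y \<le> 2" using assms pi_less_4 mult_mono [of pi 4 x "1 / 2"] by auto
  have "\<bar>sin ?y - (\<Sum>m<3. sin_coeff m * ?y ^ m)\<bar> \<le> inverse (fact 3) * \<bar>?y\<bar> ^ 3"
    by (rule Maclaurin_sin_bound)
  moreover have "(\<Sum>m<3. sin_coeff m * ?y ^ m) = ?y"
    by (simp add: numeral_3_eq_3 sin_coeff_def)
  moreover have "inverse (fact 3) * \<bar>?y\<bar> ^ 3 = ?y ^ 3 / 6"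
    using y by (simp add: fact_numeral)
  ultimately have "?y - ?y ^ 3 / 6 \<le> sin ?y"
    by linarith
  moreover have "?y ^ 3 \<le> 4 * ?y"
    using mult_mono [of ?y 2 ?y 2] y mult_right_mono [of "?y * ?y" 4 ?y]
    by (simp add: power3_eq_cube)
  ultimately have "?y / 3 \<le> sin ?y" by simp
  moreover have "x \<le> ?y / 3" using pi_gt3 assms mult_right_mono [of 3 pi x] by simp
  ultimately show ?thesis by linarith
qed

lemma sin_pi_times_powr_le:
  fixes x \<beta> :: real
  assumes x: "0 < x" "x < 1" and "\<beta> \<ge> 0"
  shows "sin (pi * x) > 0"
    and "\<bar>sin (pi * x)\<bar> powr - \<beta> \<le> x powr - \<beta> + (1 - x) powr - \<beta>"
proof -
  show pos: "sin (pi * x) > 0"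
    using x by (intro sin_gt_zero) auto
  have refl: "sin (pi * (1 - x)) = sin (pi * x)"
    by (simp add: right_diff_distrib sin_diff)
  show "\<bar>sin (pi * x)\<bar> powr - \<beta> \<le> x powr - \<beta> + (1 - x) powr - \<beta>"
  proof (cases "x \<le> 1 / 2")
    case True
    then have "sin (pi * x) powr - \<beta> \<le> x powr - \<beta>"
      using x \<open>\<beta> \<ge> 0\<close> by (intro powr_mono2' sin_pi_times_ge) auto
    then show ?thesis using pos by (simp add: add_increasing2)
  next
    case False
    then have "sin (pi * x) powr - \<beta> \<le> (1 - x) powr - \<beta>"
      using x \<open>\<beta> \<ge> 0\<close> sin_pi_times_ge [of "1 - x"] unfolding refl by (intro powr_mono2') auto
    then show ?thesis using pos by (simp add: add_increasing)
  qed
qed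

section \<open>Bessel--Fourier series with prescribed coefficients\<close>

text \<open>
  A single majorant \<open>h\<close> serves all Bessel--Fourier coefficients at once, since their kernels are
  continuous.  Bound and convergence are asked for in the open interval only, as the series
  considered below are singular at both endpoints.
\<close>

lemma dominated_convergence_times_continuous:
  fixes F :: "nat \<Rightarrow> real \<Rightarrow> real" and g h \<phi> :: "real \<Rightarrow> real"
  assumes F: "\<And>n. continuous_on {0..1} (F n)" and h: "h integrable_on {0..1}"
    and le: "\<And>n x. 0 < x \<Longrightarrow> x < 1 \<Longrightarrow> \<bar>F n x\<bar> \<le> h x"
    and lim: "\<And>x. 0 < x \<Longrightarrow> x < 1 \<Longrightarrow> (\<lambda>n. F n x) \<longlonglongrightarrow> g x"
    and \<phi>: "continuous_on {0..1} \<phi>"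
  shows "(\<lambda>x. g x * \<phi> x) absolutely_integrable_on {0..1}"
    and "(\<lambda>n. integral {0..1} (\<lambda>x. F n x * \<phi> x)) \<longlonglongrightarrow> integral {0..1} (\<lambda>x. g x * \<phi> x)"
proof -
  have "bounded (\<phi> ` {0..1})"
    using compact_continuous_image [OF \<phi>] compact_imp_bounded by blast
  then obtain B where B: "\<And>x. 0 \<le> x \<Longrightarrow> x \<le> 1 \<Longrightarrow> \<bar>\<phi> x\<bar> \<le> B"
    by (force simp: bounded_iff)
  have dom: "norm (F n x * \<phi> x) \<le> h x * B" if "x \<in> {0<..<1}" for n x
    using le [of x n] B [of x] that by (auto simp: abs_mult intro!: mult_mono)
  have F_int: "(\<lambda>x. F n x * \<phi> x) absolutely_integrable_on {0<..<1}" for n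
    unfolding absolutely_integrable_on_Icc_iff_Ioo [symmetric]
    by (intro absolutely_integrable_continuous_real continuous_intros F \<phi>)
  have h_int: "(\<lambda>x. h x * B) integrable_on {0<..<1}"
    unfolding integrable_on_Icc_iff_Ioo [symmetric] using h by (rule integrable_on_mult_left)
  have conv: "(\<lambda>n. F n x * \<phi> x) \<longlonglongrightarrow> g x * \<phi> x" if "x \<in> {0<..<1}" for x
    using lim [of x] that by (intro tendsto_intros) auto
  have g_bound: "norm (g x * \<phi> x) \<le> h x * B" if "x \<in> {0<..<1}" for x
    using dom [OF that] tendsto_norm [OF conv [OF that]] by (intro LIMSEQ_le_const2) auto
  show "(\<lambda>x. g x * \<phi> x) absolutely_integrable_on {0..1}"
    unfolding absolutely_integrable_on_Icc_iff_Ioo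
    by (rule dominated_convergence_absolutely_integrable [OF F_int h_int g_bound conv])
  show "(\<lambda>n. integral {0..1} (\<lambda>x. F n x * \<phi> x)) \<longlonglongrightarrow> integral {0..1} (\<lambda>x. g x * \<phi> x)"
    unfolding integral_open_interval_real
    by (rule dominated_convergence(2) [OF set_lebesgue_integral_eq_integral(1) [OF F_int] h_int dom conv])
qed

text \<open>
  Integrability of \<open>x f x\<close> instead of \<open>x\<^bsup>\<alpha>+1\<^esup> f x\<close> is a condition free of \<open>\<alpha>\<close>; it implies the latter
  for every \<open>\<alpha> \<ge> 0\<close>.
\<close>

definition has_bessel_coeffs :: "(real \<Rightarrow> real) \<Rightarrow> (nat \<Rightarrow> real) \<Rightarrow> bool" where
  "has_bessel_coeffs f c \<longleftrightarrow>
     (\<lambda>x. x * f x) absolutely_integrable_on {0..1} \<and> bessel_coeffs_exist f \<and>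
     (\<forall>m\<ge>1. bessel_coeff f m = c m)"

lemma has_bessel_coeffs_add:
  assumes "has_bessel_coeffs f c" "has_bessel_coeffs g d"
  shows "has_bessel_coeffs (\<lambda>x. f x + g x) (\<lambda>m. c m + d m)"
proof -
  have f: "(\<lambda>x. x * f x) absolutely_integrable_on {0..1}"
    "\<And>m. m \<ge> 1 \<Longrightarrow> (\<lambda>x. f x * bessel_J 0 (bessel_J0_zero m * x) * x) absolutely_integrable_on {0..1}"
    "\<And>m. m \<ge> 1 \<Longrightarrow> bessel_coeff f m = c m"
    and g: "(\<lambda>x. x * g x) absolutely_integrable_on {0..1}"
    "\<And>m. m \<ge> 1 \<Longrightarrow> (\<lambda>x. g x * bessel_J 0 (bessel_J0_zero m * x) * x) absolutely_integrable_on {0..1}"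
    "\<And>m. m \<ge> 1 \<Longrightarrow> bessel_coeff g m = d m"
    using assms by (auto simp: has_bessel_coeffs_def bessel_coeffs_exist_def)
  have split: "(\<lambda>x. (f x + g x) * bessel_J 0 (bessel_J0_zero m * x) * x)
      = (\<lambda>x. f x * bessel_J 0 (bessel_J0_zero m * x) * x + g x * bessel_J 0 (bessel_J0_zero m * x) * x)" for m
    by (simp add: distrib_right)
  show ?thesis
    unfolding has_bessel_coeffs_def bessel_coeffs_exist_def
  proof (intro conjI allI impI)
    show "(\<lambda>x. x * (f x + g x)) absolutely_integrable_on {0..1}"
      unfolding distrib_left by (rule set_integral_add(1) [OF f(1) g(1)])
  next
    fix m :: nat assume m: "1 \<le> m"
    show "(\<lambda>x. (f x + g x) * bessel_J 0 (bessel_J0_zero m * x) * x) absolutely_integrable_on {0..1}"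
      unfolding split by (rule set_integral_add(1) [OF f(2) [OF m] g(2) [OF m]])
    show "bessel_coeff (\<lambda>x. f x + g x) m = c m + d m"
      unfolding f(3) [OF m, symmetric] g(3) [OF m, symmetric] bessel_coeff_def split
        set_integral_add(2) [OF f(2) [OF m] g(2) [OF m]]
      by (rule distrib_left)
  qed
qed

text \<open>
  The analytic core.  The factor \<open>j\<^sub>m\<^bsup>1/2\<^esup>\<close> in the coefficients cancels the decay of \<open>J\<^sub>0 (j\<^sub>m x)\<close>
  in \<open>m\<close>, so that the series becomes \<open>x\<^bsup>-1/2\<^esup>\<close> times a cosine series with coefficients \<open>d k\<close>, up
  to an absolutely convergent error.  Along a class modulo \<open>2\<close> the frequencies grow in steps of
  \<open>2 \<pi>\<close>, and the cosine series is singular where \<open>sin (\<pi> x) = 0\<close>, that is only at the endpoints.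
\<close>

lemma bessel_series_on_residue_class:
  fixes d :: "nat \<Rightarrow> real" and \<gamma> A :: real and p :: nat
  assumes \<gamma>: "0 < \<gamma>" "\<gamma> < 1" and p: "1 \<le> p"
    and decr: "decseq d" and nonneg: "\<And>k. 0 \<le> d k"
    and upper: "\<And>k. d k \<le> A * real (Suc k) powr - \<gamma>"
  obtains f where "has_bessel_coeffs f
    (\<lambda>m. if \<exists>k. m = 2 * k + p then d ((m - p) div 2) * sqrt (bessel_J0_zero m) else 0)"
proof -
  obtain R L c C where
    zero: "\<And>m. m \<ge> 1 \<Longrightarrow> bessel_J 0 (bessel_J0_zero m) = 0" and
    J1: "\<And>m. m \<ge> 1 \<Longrightarrow> bessel_J 1 (bessel_J0_zero m) \<noteq> 0" and
    ge: "\<And>m. m \<ge> 1 \<Longrightarrow> real m \<le> bessel_J0_zero m" and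
    "\<And>m. m \<ge> 1 \<Longrightarrow> bessel_J0_zero m \<le> 5 * real m" and
    inj: "\<And>m n. m \<ge> 1 \<Longrightarrow> n \<ge> 1 \<Longrightarrow> bessel_J0_zero m = bessel_J0_zero n \<Longrightarrow> m = n" and
    near: "\<And>m. m \<ge> 1 \<Longrightarrow> \<bar>bessel_J0_zero m - (pi * real m + c)\<bar> \<le> C / real m" and
    asymp: "\<And>x. x > 0 \<Longrightarrow> \<bar>sqrt x * bessel_J 0 x - R * cos (x + L)\<bar> \<le> C / x"
    by (rule bessel_J0_zeros) blast
  have C: "0 \<le> C" using near [of 1] by simp
  have A: "0 \<le> A" using upper [of 0] nonneg [of 0] by simp
  define \<mu> where "\<mu> = (\<lambda>k. bessel_J0_zero (2 * k + p))"
  have \<mu>: "real (Suc k) \<le> \<mu> k" for k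
    using ge [of "2 * k + p"] p by (simp add: \<mu>_def)
  have \<mu>_pos: "0 < \<mu> k" for k using \<mu> [of k] by simp
  have \<mu>_near: "\<bar>\<mu> k - (pi * real (2 * k + p) + c)\<bar> \<le> C / real (Suc k)" for k
  proof -
    have "C / real (2 * k + p) \<le> C / real (Suc k)"
      using C p by (intro divide_left_mono) auto
    then show ?thesis using near [of "2 * k + p"] p unfolding \<mu>_def by fastforce
  qed

  define \<psi> where "\<psi> = (\<lambda>x. (pi * real p + c) * x + L)"
  \<comment> \<open>\<open>e k x\<close> collects the errors of the asymptotics of \<open>J\<^sub>0\<close> and of its zeros.\<close>
  define e where "e = (\<lambda>k x. sqrt (\<mu> k * x) * bessel_J 0 (\<mu> k * x) - R * cos (2 * real k * (pi * x) + \<psi> x))"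
  define D where "D = C + \<bar>R\<bar> * C"
  have e_bound: "\<bar>e k x\<bar> \<le> D / (real (Suc k) * x)" if x: "0 < x" "x < 1" for k x
  proof -
    let ?y = "(pi * real (2 * k + p) + c) * x + L"
    have y: "2 * real k * (pi * x) + \<psi> x = ?y"
      by (simp add: \<psi>_def algebra_simps)
    have "e k x = (sqrt (\<mu> k * x) * bessel_J 0 (\<mu> k * x) - R * cos (\<mu> k * x + L))
        + R * (cos (\<mu> k * x + L) - cos ?y)"
      unfolding e_def y by (simp add: right_diff_distrib)
    also have "\<bar>\<dots>\<bar> \<le> C / (\<mu> k * x) + \<bar>R\<bar> * \<bar>(\<mu> k * x + L) - ?y\<bar>"
    proof (intro order.trans [OF abs_triangle_ineq] add_mono)
      show "\<bar>sqrt (\<mu> k * x) * bessel_J 0 (\<mu> k * x) - R * cos (\<mu> k * x + L)\<bar> \<le> C / (\<mu> k * x)"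
        using x \<mu>_pos [of k] by (intro asymp) simp
      show "\<bar>R * (cos (\<mu> k * x + L) - cos ?y)\<bar> \<le> \<bar>R\<bar> * \<bar>(\<mu> k * x + L) - ?y\<bar>"
        unfolding abs_mult by (intro mult_left_mono abs_cos_diff_le) simp
    qed
    also have "(\<mu> k * x + L) - ?y = (\<mu> k - (pi * real (2 * k + p) + c)) * x"
      by (simp add: algebra_simps)
    also have "C / (\<mu> k * x) + \<bar>R\<bar> * \<bar>(\<mu> k - (pi * real (2 * k + p) + c)) * x\<bar>
        \<le> C / (real (Suc k) * x) + \<bar>R\<bar> * (C / (real (Suc k) * x))"
    proof (intro add_mono mult_left_mono)
      show "C / (\<mu> k * x) \<le> C / (real (Suc k) * x)"
        using C x \<mu> [of k] \<mu>_pos [of k] by (intro divide_left_mono mult_right_mono mult_pos_pos) auto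
      have "\<bar>(\<mu> k - (pi * real (2 * k + p) + c)) * x\<bar> \<le> C / real (Suc k) * 1"
        unfolding abs_mult using \<mu>_near [of k] x C by (intro mult_mono) auto
      also have "\<dots> \<le> C / real (Suc k) * (1 / x)"
        using x C by (intro mult_left_mono) auto
      finally show "\<bar>(\<mu> k - (pi * real (2 * k + p) + c)) * x\<bar> \<le> C / (real (Suc k) * x)"
        by simp
    qed simp
    also have "\<dots> = D / (real (Suc k) * x)"
      by (simp add: D_def add_divide_distrib)
    finally show ?thesis .
  qed
  have D: "0 \<le> D" using C by (simp add: D_def)

  define z where "z = (\<lambda>k. real (Suc k) powr (- \<gamma> - 1))"
  have z_summable: "summable z"
    unfolding z_def
    using \<gamma> summable_real_powr_iff [of "- \<gamma> - 1"] summable_Suc_iff [of "\<lambda>n. real n powr (- \<gamma> - 1)"] by simp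
  have z_nonneg: "0 \<le> z k" for k by (simp add: z_def)
  have de_bound: "\<bar>d k * e k x\<bar> \<le> A * D / x * z k" if x: "0 < x" "x < 1" for k x
  proof -
    have "\<bar>d k * e k x\<bar> \<le> A * real (Suc k) powr - \<gamma> * (D / (real (Suc k) * x))"
      unfolding abs_mult using upper [of k] nonneg [of k] e_bound [OF x] A by (intro mult_mono) auto
    also have "\<dots> = A * D / x * z k"
      by (simp add: z_def powr_diff mult_ac)
    finally show ?thesis .
  qed

  define F where "F = (\<lambda>n x. \<Sum>k<n. d k * sqrt (\<mu> k) * bessel_J 0 (\<mu> k * x))"
  have F_split: "sqrt x * F n x = R * (\<Sum>k<n. d k * cos (2 * real k * (pi * x) + \<psi> x)) + (\<Sum>k<n. d k * e k x)"
    for n x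
    by (simp add: F_def e_def sum_distrib_left sum.distrib [symmetric] real_sqrt_mult algebra_simps)
  define B where "B = \<bar>R\<bar> * (A * (2 / (1 - \<gamma>) + 1))"
  have B: "0 \<le> B" using A \<gamma> by (simp add: B_def)
  define h where "h = (\<lambda>x. B * (x powr (\<gamma> - 1) + (1 - x) powr (\<gamma> - 1)) + A * D * suminf z * x powr (- (1 / 2)))"
  have F_bound: "\<bar>x * F n x\<bar> \<le> h x" if x: "0 < x" "x < 1" for n x
  proof -
    have sin: "sin (pi * x) \<noteq> 0" and
      sin_le: "\<bar>sin (pi * x)\<bar> powr (\<gamma> - 1) \<le> x powr (\<gamma> - 1) + (1 - x) powr (\<gamma> - 1)"
      using sin_pi_times_powr_le [OF x, of "1 - \<gamma>"] \<gamma> by auto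
    have main: "\<bar>\<Sum>k<n. d k * cos (2 * real k * (pi * x) + \<psi> x)\<bar>
        \<le> A * (2 / (1 - \<gamma>) + 1) * (x powr (\<gamma> - 1) + (1 - x) powr (\<gamma> - 1))"
      using \<gamma> A
      by (intro order.trans [OF abs_monotone_cos_sum_le [OF _ _ decr nonneg upper sin]] mult_left_mono sin_le) auto
    have "\<bar>\<Sum>k<n. d k * e k x\<bar> \<le> (\<Sum>k<n. A * D / x * z k)"
      by (intro order.trans [OF sum_abs] sum_mono de_bound x)
    also have "\<dots> \<le> A * D / x * suminf z"
      unfolding sum_distrib_left [symmetric]
      using A D x z_nonneg by (intro mult_left_mono sum_le_suminf z_summable) auto
    finally have err: "\<bar>\<Sum>k<n. d k * e k x\<bar> \<le> A * D / x * suminf z" .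
    have "x * F n x = sqrt x * (sqrt x * F n x)"
      using x by (simp add: mult.assoc [symmetric])
    then have "\<bar>x * F n x\<bar> = sqrt x * \<bar>R * (\<Sum>k<n. d k * cos (2 * real k * (pi * x) + \<psi> x)) + (\<Sum>k<n. d k * e k x)\<bar>"
      using x unfolding F_split by (simp add: abs_mult)
    also have "\<dots> \<le> sqrt x * (B * (x powr (\<gamma> - 1) + (1 - x) powr (\<gamma> - 1)) + A * D / x * suminf z)"
      using main err x unfolding B_def mult.assoc [of "\<bar>R\<bar>"]
      by (intro mult_left_mono order.trans [OF abs_triangle_ineq] add_mono)
         (auto simp: abs_mult intro!: mult_left_mono)
    also have "\<dots> \<le> h x"
    proof -
      have "sqrt x * (B * (x powr (\<gamma> - 1) + (1 - x) powr (\<gamma> - 1)))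
          \<le> 1 * (B * (x powr (\<gamma> - 1) + (1 - x) powr (\<gamma> - 1)))"
        using x B by (intro mult_right_mono) auto
      moreover have "sqrt x * (A * D / x * suminf z) = A * D * suminf z * x powr (- (1 / 2))"
        using x by (simp add: powr_minus powr_half_sqrt real_div_sqrt field_simps)
      ultimately show ?thesis by (simp add: h_def distrib_left)
    qed
    finally show ?thesis .
  qed
  have h_int: "h integrable_on {0..1}"
  proof -
    have "(\<lambda>x. x powr (\<gamma> - 1)) integrable_on {0..1}" "(\<lambda>x. x powr (- (1 / 2))) integrable_on {0..1::real}"
      using \<gamma> by (intro integrable_on_powr_from_0; simp)+
    moreover from this(1) have "(\<lambda>x. (1 - x) powr (\<gamma> - 1)) integrable_on {0..1}"
      using integrable_affinity [of "\<lambda>x. x powr (\<gamma> - 1)" 0 1 "-1" 1] by (simp add: image_affinity_atLeastAtMost)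
    ultimately show ?thesis
      unfolding h_def by (intro integrable_add integrable_on_mult_right)
  qed
  have d_lim: "d \<longlonglongrightarrow> 0"
  proof (rule tendsto_sandwich [of "\<lambda>_. 0" d _ "\<lambda>k. A * real (Suc k) powr - \<gamma>"])
    have "(\<lambda>k. A * real (Suc k) powr - \<gamma>) \<longlonglongrightarrow> A * 0"
      using \<gamma> by (intro tendsto_mult_left LIMSEQ_Suc [of "\<lambda>n. real n powr - \<gamma>"] tendsto_neg_powr filterlim_real_sequentially) auto
    then show "(\<lambda>k. A * real (Suc k) powr - \<gamma>) \<longlonglongrightarrow> 0" by simp
  qed (use nonneg upper in auto)
  define f where "f = (\<lambda>x. lim (\<lambda>n. F n x))"
  have F_lim: "(\<lambda>n. x * F n x) \<longlonglongrightarrow> x * f x" if x: "0 < x" "x < 1" for x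
  proof -
    have "summable (\<lambda>k. d k * cos (2 * real k * (pi * x) + \<psi> x))"
      using sin_pi_times_powr_le(1) [OF x, of 0] by (intro summable_monotone_cos decr nonneg d_lim) auto
    moreover have "summable (\<lambda>k. d k * e k x)"
      by (rule summable_comparison_test' [OF summable_mult [OF z_summable]])
         (simp only: real_norm_def, rule de_bound [OF x])
    ultimately have "convergent (\<lambda>n. R * (\<Sum>k<n. d k * cos (2 * real k * (pi * x) + \<psi> x)) + (\<Sum>k<n. d k * e k x))"
      unfolding summable_iff_convergent by (intro convergent_add convergent_mult convergent_const)
    then have "convergent (\<lambda>n. (1 / sqrt x) * (sqrt x * F n x))"
      unfolding F_split [symmetric] by (rule convergent_mult [OF convergent_const])
    moreover have "(1 / sqrt x) * (sqrt x * F n x) = F n x" for n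
      using x by simp
    ultimately have "convergent (\<lambda>n. F n x)"
      by (simp only:)
    then show ?thesis
      unfolding f_def by (intro tendsto_mult_left) (simp add: convergent_LIMSEQ_iff)
  qed
  have F_cont: "continuous_on {0..1} (\<lambda>x. x * F n x)" for n
    unfolding F_def by (intro continuous_intros)
  have abs_int: "(\<lambda>x. x * f x * \<phi> x) absolutely_integrable_on {0..1}"
    and conv: "(\<lambda>n. integral {0..1} (\<lambda>x. x * F n x * \<phi> x)) \<longlonglongrightarrow> integral {0..1} (\<lambda>x. x * f x * \<phi> x)"
    if "continuous_on {0..1} \<phi>" for \<phi>
    using dominated_convergence_times_continuous [OF F_cont h_int F_bound F_lim that] by blast+
  have "has_bessel_coeffs f
    (\<lambda>m. if \<exists>k. m = 2 * k + p then d ((m - p) div 2) * sqrt (bessel_J0_zero m) else 0)"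
    unfolding has_bessel_coeffs_def bessel_coeffs_exist_def
  proof (intro conjI allI impI)
    show "(\<lambda>x. x * f x) absolutely_integrable_on {0..1}"
      using abs_int [of "\<lambda>x. 1"] by simp
  next
    fix m :: nat assume m: "1 \<le> m"
    let ?j = "bessel_J0_zero m"
    have \<phi>: "continuous_on {0..1} (\<lambda>x. bessel_J 0 (?j * x))"
      by (intro continuous_intros)
    show exists: "(\<lambda>x. f x * bessel_J 0 (?j * x) * x) absolutely_integrable_on {0..1}"
      using abs_int [OF \<phi>] by (simp add: mult_ac)
    let ?I = "\<lambda>k. d k * sqrt (\<mu> k) * (if \<mu> k = ?j then (bessel_J 1 (\<mu> k))\<^sup>2 / 2 else 0)"
    have partial: "integral {0..1} (\<lambda>x. x * F n x * bessel_J 0 (?j * x)) = (\<Sum>k<n. ?I k)" for n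
    proof (rule integral_unique)
      have "((\<lambda>x. \<Sum>k<n. d k * sqrt (\<mu> k) * (bessel_J 0 (\<mu> k * x) * bessel_J 0 (?j * x) * x))
          has_integral (\<Sum>k<n. ?I k)) {0..1}"
        using zero m p \<mu>_pos ge [of m]
        by (intro has_integral_sum has_integral_mult_right bessel_J0_integral) (auto simp: \<mu>_def)
      then show "((\<lambda>x. x * F n x * bessel_J 0 (?j * x)) has_integral (\<Sum>k<n. ?I k)) {0..1}"
        by (simp add: F_def sum_distrib_left sum_distrib_right mult_ac)
    qed
    have "?I sums integral {0..1} (\<lambda>x. x * f x * bessel_J 0 (?j * x))"
      using conv [OF \<phi>] unfolding partial sums_def .
    moreover have "(\<lambda>x. x * f x * bessel_J 0 (?j * x)) = (\<lambda>x. f x * bessel_J 0 (?j * x) * x)"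
      by (simp add: mult_ac)
    ultimately have coeff: "bessel_coeff f m = 2 / (bessel_J 1 ?j)\<^sup>2 * suminf ?I"
      unfolding bessel_coeff_def set_lebesgue_integral_eq_integral(2) [OF exists]
      by (simp add: sums_iff)
    show "bessel_coeff f m = (if \<exists>k. m = 2 * k + p then d ((m - p) div 2) * sqrt ?j else 0)"
    proof (cases "\<exists>k. m = 2 * k + p")
      case True
      then obtain k0 where k0: "m = 2 * k0 + p" by blast
      have "?I k = (if k = k0 then d k0 * sqrt ?j * ((bessel_J 1 ?j)\<^sup>2 / 2) else 0)" for k
        using inj [of "2 * k + p" m] m p by (auto simp: \<mu>_def k0)
      then have sum: "suminf ?I = d k0 * sqrt ?j * ((bessel_J 1 ?j)\<^sup>2 / 2)"
        using suminf_finite [of "{k0}" "\<lambda>k. if k = k0 then d k0 * sqrt ?j * ((bessel_J 1 ?j)\<^sup>2 / 2) else 0"] by simp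
      then show ?thesis
        using True J1 [OF m] unfolding coeff sum by (simp add: k0 del: One_nat_def)
    next
      case False
      then have "?I k = 0" for k
        using inj [of "2 * k + p" m] m p by (auto simp: \<mu>_def)
      then have sum: "suminf ?I = 0"
        by (simp only: suminf_zero)
      show ?thesis using False unfolding coeff sum by simp
    qed
  qed
  then show ?thesis by (rule that)
qed

section \<open>Series dominating a given null sequence\<close>

lemma decreasing_null_majorant:
  fixes a :: "nat \<Rightarrow> real"
  assumes "a \<longlonglongrightarrow> 0"
  obtains s where "decseq s" "\<And>m. 0 \<le> s m" "\<And>m. a m \<le> s m" "s \<longlonglongrightarrow> 0"
proof -
  define s where "s = (\<lambda>m. SUP n\<in>{m..}. \<bar>a n\<bar>)"
  have "Bseq a"
    using assms by (intro convergent_imp_Bseq convergentI)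
  then obtain K where "\<And>n. \<bar>a n\<bar> \<le> K"
    by (auto simp: Bseq_def)
  then have bdd: "bdd_above ((\<lambda>n. \<bar>a n\<bar>) ` {m..})" for m
    by (intro bdd_aboveI2)
  have le: "\<bar>a n\<bar> \<le> s m" if "m \<le> n" for m n
    unfolding s_def using that by (intro cSUP_upper bdd) auto
  have nonneg: "0 \<le> s m" for m
    using le [of m m] by simp
  have "decseq s"
    unfolding s_def by (intro decseq_SucI cSUP_subset_mono bdd) auto
  moreover have "a m \<le> s m" for m
    using le [of m m] by simp
  moreover have "s \<longlonglongrightarrow> 0"
  proof (rule LIMSEQ_I)
    fix e :: real assume "0 < e"
    then obtain N where N: "\<And>n. n \<ge> N \<Longrightarrow> \<bar>a n\<bar> < e / 2"
      using LIMSEQ_D [OF assms, of "e / 2"] by auto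
    have "s m \<le> e / 2" if "m \<ge> N" for m
      unfolding s_def using that N by (intro cSUP_least less_imp_le) auto
    then show "\<exists>N. \<forall>m\<ge>N. norm (s m - 0) < e"
      using \<open>0 < e\<close> nonneg by (intro exI [of _ N]) fastforce
  qed
  ultimately show ?thesis
    using nonneg by (intro that [of s])
qed

theorem theorem1p4:
  fixes \<alpha> :: real and a :: "nat \<Rightarrow> real"
  assumes "0 \<le> \<alpha>" and "\<alpha> < 1 / 2"
    and "\<And>m. m \<ge> 1 \<Longrightarrow> 0 \<le> a m"
    and "a \<longlonglongrightarrow> 0"
  shows
    "(\<exists>f :: real \<Rightarrow> real.
        (\<lambda>x. x powr (\<alpha> + 1) * f x) absolutely_integrable_on {0..1} \<and>
        bessel_coeffs_exist f \<and>
        (\<forall>m\<ge>1. 0 \<le> a m \<and> a m \<le> bessel_coeff f m / bessel_J0_zero m powr \<alpha>) \<and>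
        (\<lambda>m. bessel_coeff f m / bessel_J0_zero m powr \<alpha>) \<longlonglongrightarrow> 0) \<and>
     (\<exists>f :: real \<Rightarrow> real.
        (\<lambda>x. x powr (\<alpha> + 1) * f x) absolutely_integrable_on {0..1} \<and>
        bessel_coeffs_exist f \<and>
        (\<forall>m\<ge>1. (\<nexists>k. k \<ge> 1 \<and> m = 2 * k) \<longrightarrow>
          0 \<le> a m \<and> a m \<le> bessel_coeff f m / bessel_J0_zero m powr \<alpha>) \<and>
        (\<lambda>m. bessel_coeff f m / bessel_J0_zero m powr \<alpha>) \<longlonglongrightarrow> 0 \<and>
        (\<forall>m\<ge>1. bessel_coeff f (2 * m) = 0)) \<and>
     (\<exists>f :: real \<Rightarrow> real.
        (\<lambda>x. x powr (\<alpha> + 1) * f x) absolutely_integrable_on {0..1} \<and>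
        bessel_coeffs_exist f \<and>
        (\<forall>m\<ge>1. (\<nexists>k. k \<ge> 1 \<and> m = 2 * k + 1) \<longrightarrow>
          0 \<le> a m \<and> a m \<le> bessel_coeff f m / bessel_J0_zero m powr \<alpha>) \<and>
        (\<lambda>m. bessel_coeff f m / bessel_J0_zero m powr \<alpha>) \<longlonglongrightarrow> 0 \<and>
        (\<forall>m\<ge>1. bessel_coeff f (2 * m + 1) = 0))"
proof -
  define \<gamma> where "\<gamma> = 1 / 2 - \<alpha>"
  have \<gamma>: "0 < \<gamma>" "\<gamma> \<le> 1 / 2" "\<gamma> < 1"
    using assms by (auto simp: \<gamma>_def)
  have j: "real m \<le> bessel_J0_zero m" "bessel_J0_zero m \<le> 5 * real m" if "m \<ge> 1" for m
    by (rule bessel_J0_zeros; use that in blast)+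
  obtain s where s: "decseq s" "\<And>m. 0 \<le> s m" "\<And>m. a m \<le> s m" "s \<longlonglongrightarrow> 0"
    by (rule decreasing_null_majorant [OF assms(4)]) blast
  define b where "b = (\<lambda>m. s m * real m powr - \<gamma>)"
  define c where "c = (\<lambda>m. b m * sqrt (bessel_J0_zero m))"
  have b_le: "b m \<le> s 0 * real m powr - \<gamma>" for m
    unfolding b_def using s(1) by (intro mult_right_mono) (auto simp: decseq_def)

  have ratio: "c m / bessel_J0_zero m powr \<alpha> = s m * (bessel_J0_zero m / real m) powr \<gamma>" if "m \<ge> 1" for m
  proof -
    have pos: "0 < bessel_J0_zero m" "0 < real m" using j [OF that] that by auto
    then have "sqrt (bessel_J0_zero m) = bessel_J0_zero m powr \<gamma> * bessel_J0_zero m powr \<alpha>"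
      by (simp add: \<gamma>_def powr_half_sqrt flip: powr_add)
    then show ?thesis
      using pos by (simp add: c_def b_def powr_divide powr_minus field_simps)
  qed
  have lower: "a m \<le> c m / bessel_J0_zero m powr \<alpha>" if "m \<ge> 1" for m
  proof -
    have "1 \<le> (bessel_J0_zero m / real m) powr \<gamma>"
      using j [OF that] that \<gamma> by (intro ge_one_powr_ge_zero) auto
    then have "s m * 1 \<le> c m / bessel_J0_zero m powr \<alpha>"
      unfolding ratio [OF that] using s(2) by (intro mult_left_mono)
    then show ?thesis using s(3) [of m] by simp
  qed
  have upper: "\<bar>c m / bessel_J0_zero m powr \<alpha>\<bar> \<le> 5 * s m" if "m \<ge> 1" for m
  proof -
    have "(bessel_J0_zero m / real m) powr \<gamma> \<le> 5 powr \<gamma>"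
      using j [OF that] that \<gamma> by (intro powr_mono2) (auto simp: field_simps)
    also have "\<dots> \<le> 5 powr 1"
      using \<gamma> by (intro powr_mono) auto
    finally show ?thesis
      unfolding ratio [OF that] using s(2) [of m] by (simp add: abs_mult mult_left_mono mult.commute [of 5])
  qed

  have branch: "\<exists>f. has_bessel_coeffs f (\<lambda>m. if \<exists>k. m = 2 * k + p then c m else 0)" if p: "1 \<le> p" for p
  proof -
    have decr: "decseq (\<lambda>k. b (2 * k + p))"
    proof (rule decseq_SucI)
      fix k
      show "b (2 * Suc k + p) \<le> b (2 * k + p)"
        unfolding b_def using s(1,2) \<gamma> p
        by (intro mult_mono powr_mono2') (auto simp: decseq_def)
    qed
    have bound: "b (2 * k + p) \<le> s 0 * real (Suc k) powr - \<gamma>" for k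
    proof -
      have "real (2 * k + p) powr - \<gamma> \<le> real (Suc k) powr - \<gamma>"
        using \<gamma> p by (intro powr_mono2') auto
      then show ?thesis
        using b_le [of "2 * k + p"] s(2) [of 0] by (meson mult_left_mono order_trans)
    qed
    obtain f where f: "has_bessel_coeffs f
        (\<lambda>m. if \<exists>k. m = 2 * k + p then b (2 * ((m - p) div 2) + p) * sqrt (bessel_J0_zero m) else 0)"
      by (rule bessel_series_on_residue_class [OF \<gamma>(1,3) p decr _ bound]) (use s(2) in \<open>auto simp: b_def\<close>)
    have "(\<lambda>m. if \<exists>k. m = 2 * k + p then b (2 * ((m - p) div 2) + p) * sqrt (bessel_J0_zero m) else 0)
        = (\<lambda>m. if \<exists>k. m = 2 * k + p then c m else 0)"
      by (intro ext if_cong refl) (auto simp: c_def)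
    with f show ?thesis by auto
  qed

  obtain odd_part where odd_part: "has_bessel_coeffs odd_part (\<lambda>m. if \<exists>k. m = 2 * k + 1 then c m else 0)"
    using branch [of 1] by auto
  obtain even_part where even_part: "has_bessel_coeffs even_part (\<lambda>m. if \<exists>k. m = 2 * k + 2 then c m else 0)"
    using branch [of 2] by auto
  \<comment> \<open>The third part leaves \<open>m = 1\<close> unconstrained by the vanishing condition, so a multiple of
    \<open>J\<^sub>0 (j\<^sub>1 x)\<close> supplies the first coefficient.\<close>
  obtain first_part where first_part: "has_bessel_coeffs first_part (\<lambda>m. if m = 1 then c 1 else 0)"
  proof -
    let ?d = "\<lambda>k. if k = (0::nat) then b 1 else 0"
    have "0 \<le> b 1" using s(2) by (simp add: b_def)
    obtain f where f: "has_bessel_coeffs f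
        (\<lambda>m. if \<exists>k. m = 2 * k + 1 then ?d ((m - 1) div 2) * sqrt (bessel_J0_zero m) else 0)"
      by (rule bessel_series_on_residue_class [OF \<gamma>(1,3), of 1 ?d "b 1"])
         (use \<open>0 \<le> b 1\<close> in \<open>auto simp: decseq_def\<close>)
    have "(\<lambda>m. if \<exists>k. m = 2 * k + 1 then ?d ((m - 1) div 2) * sqrt (bessel_J0_zero m) else 0)
        = (\<lambda>m. if m = 1 then c 1 else 0)"
      by (rule ext) (auto simp: c_def)
    with f show ?thesis by (intro that [of f]) simp
  qed

  have weight: "(\<lambda>x. x powr (\<alpha> + 1) * f x) absolutely_integrable_on {0..1}"
    if "has_bessel_coeffs f c'" for f c'
  proof -
    have "(\<lambda>x. x powr \<alpha> * (x * f x)) absolutely_integrable_on {0..1}"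
    proof (rule absolutely_integrable_bounded_measurable_product_real)
      show "(\<lambda>x. x powr \<alpha>) \<in> borel_measurable (lebesgue_on {0..1})"
        by (intro measurable_restrict_space1 measurable_completion) measurable
      have "\<bar>x powr \<alpha>\<bar> \<le> 1" if "0 \<le> x" "x \<le> 1" for x
        using that assms(1) by (simp add: powr_le1)
      then show "bounded ((\<lambda>x. x powr \<alpha>) ` {0..1})"
        unfolding bounded_iff by (intro exI [of _ 1]) auto
      show "(\<lambda>x. x * f x) absolutely_integrable_on {0..1}"
        using that by (simp add: has_bessel_coeffs_def)
    qed auto
    then show ?thesis
      by (rule absolutely_integrable_spike [of _ _ "{}"]) (auto simp: powr_add)
  qed
  have exist: "bessel_coeffs_exist f" if "has_bessel_coeffs f c'" for f c'
    using that by (simp add: has_bessel_coeffs_def)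
  have coeff: "bessel_coeff f m = c' m" if "has_bessel_coeffs f c'" "m \<ge> 1" for f c' m
    using that by (simp add: has_bessel_coeffs_def)
  have limit: "(\<lambda>m. bessel_coeff f m / bessel_J0_zero m powr \<alpha>) \<longlonglongrightarrow> 0"
    if f: "has_bessel_coeffs f c'" and c': "\<And>m. m \<ge> 1 \<Longrightarrow> c' m = c m \<or> c' m = 0" for f c'
  proof (rule Lim_null_comparison)
    show "(\<lambda>m. 5 * s m) \<longlonglongrightarrow> 0"
      using tendsto_mult_left [OF s(4), of 5] by simp
    show "\<forall>\<^sub>F m in sequentially. norm (bessel_coeff f m / bessel_J0_zero m powr \<alpha>) \<le> 5 * s m"
      using eventually_ge_at_top [of 1]
    proof eventually_elim
      case (elim m)
      then show ?case
        using coeff [OF f elim] c' [OF elim] upper [OF elim] s(2) [of m] by auto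
    qed
  qed

  show ?thesis
  proof (intro conjI)
    let ?f = "\<lambda>x. odd_part x + even_part x"
    have f: "has_bessel_coeffs ?f (\<lambda>m. (if \<exists>k. m = 2 * k + 1 then c m else 0) + (if \<exists>k. m = 2 * k + 2 then c m else 0))"
      by (rule has_bessel_coeffs_add [OF odd_part even_part])
    have c: "(if \<exists>k. m = 2 * k + 1 then c m else 0) + (if \<exists>k. m = 2 * k + 2 then c m else 0) = c m"
      if "m \<ge> 1" for m :: nat
      using that by (auto; presburger)
    show "\<exists>f :: real \<Rightarrow> real.
        (\<lambda>x. x powr (\<alpha> + 1) * f x) absolutely_integrable_on {0..1} \<and>
        bessel_coeffs_exist f \<and>
        (\<forall>m\<ge>1. 0 \<le> a m \<and> a m \<le> bessel_coeff f m / bessel_J0_zero m powr \<alpha>) \<and>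
        (\<lambda>m. bessel_coeff f m / bessel_J0_zero m powr \<alpha>) \<longlonglongrightarrow> 0"
      using assms(3) lower c
      by (intro exI [of _ ?f] conjI allI impI weight [OF f] exist [OF f] limit [OF f]) (simp_all add: coeff [OF f])
  next
    let ?f = odd_part
    note f = odd_part
    have c: "\<exists>k. m = 2 * k + 1" if "m \<ge> 1" "\<nexists>k. k \<ge> 1 \<and> m = 2 * k" for m :: nat
      using that by presburger
    show "\<exists>f :: real \<Rightarrow> real.
        (\<lambda>x. x powr (\<alpha> + 1) * f x) absolutely_integrable_on {0..1} \<and>
        bessel_coeffs_exist f \<and>
        (\<forall>m\<ge>1. (\<nexists>k. k \<ge> 1 \<and> m = 2 * k) \<longrightarrow>
          0 \<le> a m \<and> a m \<le> bessel_coeff f m / bessel_J0_zero m powr \<alpha>) \<and>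
        (\<lambda>m. bessel_coeff f m / bessel_J0_zero m powr \<alpha>) \<longlonglongrightarrow> 0 \<and>
        (\<forall>m\<ge>1. bessel_coeff f (2 * m) = 0)"
    proof (intro exI [of _ ?f] conjI allI impI weight [OF f] exist [OF f] limit [OF f])
      fix m :: nat assume m: "1 \<le> m"
      show "0 \<le> a m" by (rule assms(3) [OF m])
      show "a m \<le> bessel_coeff ?f m / bessel_J0_zero m powr \<alpha>" if "\<nexists>k. k \<ge> 1 \<and> m = 2 * k"
        unfolding coeff [OF f m] using lower [OF m] c [OF m that] by simp
      have "1 \<le> 2 * m" "\<nexists>k. 2 * m = 2 * k + 1" using m by presburger+
      then show "bessel_coeff ?f (2 * m) = 0"
        by (subst coeff [OF f]) auto
    qed auto
  next
    let ?f = "\<lambda>x. first_part x + even_part x"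
    have f: "has_bessel_coeffs ?f (\<lambda>m. (if m = 1 then c 1 else 0) + (if \<exists>k. m = 2 * k + 2 then c m else 0))"
      by (rule has_bessel_coeffs_add [OF first_part even_part])
    have c: "m = 1 \<or> (\<exists>k. m = 2 * k + 2)" if "m \<ge> 1" "\<nexists>k. k \<ge> 1 \<and> m = 2 * k + 1" for m :: nat
      using that by presburger
    show "\<exists>f :: real \<Rightarrow> real.
        (\<lambda>x. x powr (\<alpha> + 1) * f x) absolutely_integrable_on {0..1} \<and>
        bessel_coeffs_exist f \<and>
        (\<forall>m\<ge>1. (\<nexists>k. k \<ge> 1 \<and> m = 2 * k + 1) \<longrightarrow>
          0 \<le> a m \<and> a m \<le> bessel_coeff f m / bessel_J0_zero m powr \<alpha>) \<and>
        (\<lambda>m. bessel_coeff f m / bessel_J0_zero m powr \<alpha>) \<longlonglongrightarrow> 0 \<and>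
        (\<forall>m\<ge>1. bessel_coeff f (2 * m + 1) = 0)"
    proof (intro exI [of _ ?f] conjI allI impI weight [OF f] exist [OF f] limit [OF f])
      fix m :: nat assume m: "1 \<le> m"
      show "0 \<le> a m" by (rule assms(3) [OF m])
      show "a m \<le> bessel_coeff ?f m / bessel_J0_zero m powr \<alpha>" if "\<nexists>k. k \<ge> 1 \<and> m = 2 * k + 1"
        unfolding coeff [OF f m] using lower [OF m] c [OF m that] by auto
      have "1 \<le> 2 * m + 1" "2 * m + 1 \<noteq> 1" "\<nexists>k. 2 * m + 1 = 2 * k + 2" using m by presburger+
      then show "bessel_coeff ?f (2 * m + 1) = 0"
        by (subst coeff [OF f]) auto
    qed auto
  qed
qed

end
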